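(* Let $\mathbf{k}$ be a commutative ring. Let $\operatorname{PNSym}^{(2)}$ be the non-unital $\mathbf{k}$-algebra $\operatorname{PNSym}$ with multiplication $\ast$ (the internal multiplication). Then every connected graded $\mathbf{k}$-bialgebra $H$ becomes a $\operatorname{PNSym}^{(2)}$-module, with $F_{\alpha,\sigma}$ acting as $p_{\alpha,\sigma}$. Moreover, the action of an external product $uv=u\cdot v$ of two elements $u,v\in\operatorname{PNSym}$ on $H$ is the convolution of the action of $u$ with the action of $v$.
   Context: $\mathbb{N}=\{0,1,2,\ldots\}$; $[k]=\{1,\ldots,k\}$; $\mathfrak{S}_k$ is the group of permutations of $[k]$. All modules and tensor products are over the commutative ring $\mathbf{k}$. A weak composition is a finite tuple of nonnegative integers; a composition is a finite tuple of positive integers. Maps $p_{\alpha,\sigma}$: a graded bialgebra $H=\bigoplus_{n\in\mathbb{N}}H_n$ has graded structure maps (no sign twists) and is connected if $H_0=\mathbf{k}\cdot1_H$. $p_n:H\to H$ is the projection onto $H_n$; $m^{[k]}:H^{\otimes k}\to H$ and $\Delta^{[k]}:H\to H^{\otimes k}$ are the $k$-fold iterated multiplication and comultiplication ($m^{[0]}=u$ the unit map, $\Delta^{[0]}=\epsilon$ the counit); $\mathfrak{S}_k$ acts on $H^{\otimes k}$ by $\sigma\cdot(h_1\otimes\cdots\otimes h_k)=h_{\sigma^{-1}(1)}\otimes\cdots\otimes h_{\sigma^{-1}(k)}$; and for $\alpha\in\mathbb{N}^k$, $\sigma\in\mathfrak{S}_k$, $p_{\alpha,\sigma}:=m^{[k]}\circ(p_{\alpha_1}\otimes\cdots\otimes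 p_{\alpha_k})\circ\sigma^{-1}\circ\Delta^{[k]}$. The convolution of $f,g\in\operatorname{End}H$ is $f\star g=m\circ(f\otimes g)\circ\Delta$. A mopiscotion (resp. weak mopiscotion) is a pair $(\alpha,\sigma)$ where $\alpha$ is a composition (resp. weak composition) of some length $k\in\mathbb{N}$ and $\sigma\in\mathfrak{S}_k$. The standardization of a list $w=(w_1,\ldots,w_h)$ of integers is the unique $\sigma\in\mathfrak{S}_h$ such that for all $a<b$ in $[h]$ we have $\sigma(a)<\sigma(b)\Leftrightarrow w_a\le w_b$. For a weak mopiscotion $(\alpha,\sigma)$ with $\alpha=(\alpha_1,\ldots,\alpha_k)$, let $(j_1<\cdots<j_h)$ be the list of all $i\in[k]$ with $\alpha_i\ne0$, let $\tau$ be the standardization of $(\sigma(j_1),\ldots,\sigma(j_h))$, and set $\operatorname{red}(\alpha,\sigma):=((\alpha_{j_1},\ldots,\alpha_{j_h}),\tau)$, a mopiscotion. For $\sigma\in\mathfrak{S}_k$, $\tau\in\mathfrak{S}_\ell$: $\sigma\oplus\tau\in\mathfrak{S}_{k+\ell}$ sends each $i\le k$ to $\sigma(i)$ and each $j>k$ to $k+\tau(j-k)$; and $\tau[\sigma]\in\mathfrak{S}_{k\ell}$ sends each $\ell(i-1)+j$ ($i\in[k]$, $j\in[\ell]$) to $k(\tau(j)-1)+\sigma(i)$. The concatenation of $\alpha$ and $\beta$ is denoted $\alpha\beta$. $\operatorname{PNSym}$ is the free $\mathbf{k}$-module with basis $(F_{\alpha,\sigma})$ indexed by all mopiscotions. For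 any weak mopiscotion $(\alpha,\sigma)$ set $F_{\alpha,\sigma}:=F_{\beta,\tau}$ where $(\beta,\tau)=\operatorname{red}(\alpha,\sigma)$. External multiplication is the bilinear operation with $F_{\alpha,\sigma}\cdot F_{\beta,\tau}=F_{\alpha\beta,\sigma\oplus\tau}$. Internal multiplication is the bilinear operation with (for $\alpha$ of length $k$, $\beta$ of length $\ell$) $F_{\alpha,\sigma}\ast F_{\beta,\tau}=\sum F_{(\gamma_{1,1},\gamma_{1,2},\ldots,\gamma_{k,\ell}),\,\tau[\sigma]}$, summed over all $(\gamma_{i,j})\in\mathbb{N}^{k\times\ell}$ with $\sum_j\gamma_{i,j}=\alpha_i$ for all $i$ and $\sum_i\gamma_{i,j}=\beta_j$ for all $j$, where the entries are listed in lexicographic order of $(i,j)$. Both multiplications are associative. A module over a non-unital algebra $A$ is a $\mathbf{k}$-module $H$ with a $\mathbf{k}$-bilinear action satisfying $(a\ast b)h=a(bh)$. *)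

theory Defs
  imports "HOL-Library.Poly_Mapping" "HOL-Combinatorics.Permutations"
begin

section \<open>Modules and formal linear combinations\<close>

text \<open>
  The base ring is a type of sort \<open>{comm_ring, comm_monoid_mult}\<close>, i.e. a commutative ring with
  unity. Unlike \<open>comm_ring_1\<close>, this sort does not require \<open>0 \<noteq> 1\<close>, so that the zero ring is
  included. Since the library locale \<open>module\<close> is tied to \<open>comm_ring_1\<close>, its axioms are repeated
  here. For the same reason, algebras have the sort \<open>{ring, monoid_mult}\<close> rather than \<open>ring_1\<close>.
\<close>

locale unital_module =
  fixes scale :: "'k::{comm_ring, comm_monoid_mult} \<Rightarrow> 'v::ab_group_add \<Rightarrow> 'v"
  assumes scale_right_distrib: "scale c (x + y) = scale c x + scale c y"
    and scale_left_distrib: "scale (c + d) x = scale c x + scale d x"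
    and scale_scale: "scale c (scale d x) = scale (c * d) x"
    and scale_one: "scale 1 x = x"

definition linear_map ::
    "('k \<Rightarrow> 'v::ab_group_add \<Rightarrow> 'v) \<Rightarrow> ('k \<Rightarrow> 'w::ab_group_add \<Rightarrow> 'w) \<Rightarrow> ('v \<Rightarrow> 'w) \<Rightarrow> bool" where
  "linear_map s t f \<longleftrightarrow> (\<forall>x y. f (x + y) = f x + f y) \<and> (\<forall>c x. f (s c x) = t c (f x))"

text \<open>\<open>'b \<Rightarrow>\<^sub>0 'k\<close> serves as the free module with basis \<open>'b\<close>; \<open>fscale\<close> is its scalar
  multiplication, and \<open>lin_ext s f\<close> is the linear map sending each basis element \<open>b\<close> to \<open>f b\<close>.\<close>

definition fscale :: "'k::{comm_ring, comm_monoid_mult} \<Rightarrow> ('b \<Rightarrow>\<^sub>0 'k) \<Rightarrow> ('b \<Rightarrow>\<^sub>0 'k)" where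
  "fscale c x = Poly_Mapping.map ((*) c) x"

definition lin_ext ::
    "('k::{comm_ring, comm_monoid_mult} \<Rightarrow> 'v::ab_group_add \<Rightarrow> 'v) \<Rightarrow> ('b \<Rightarrow> 'v) \<Rightarrow> ('b \<Rightarrow>\<^sub>0 'k) \<Rightarrow> 'v" where
  "lin_ext s f x = (\<Sum>b\<in>Poly_Mapping.keys x. s (Poly_Mapping.lookup x b) (f b))"

section \<open>Tensor powers\<close>

text \<open>
  The tensor power of degree \<open>n\<close> of a module \<open>'h\<close> with scalar multiplication \<open>s\<close> is the quotient
  of the free module on the lists of length \<open>n\<close> over \<open>'h\<close> by the submodule \<open>tensor_null s n\<close>
  generated by the multilinearity relations; the list \<open>[h\<^sub>1, \<dots>, h\<^sub>n]\<close> stands for the pure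
  tensor of \<open>h\<^sub>1, \<dots>, h\<^sub>n\<close>. Tensors are cosets, hence sets of formal linear combinations of
  lists. The tensor power of degree 0 is the base ring (multiples of the empty list), that of
  degree 1 is \<open>'h\<close> itself, and the identifications between iterated tensor products are
  concatenations of lists.
\<close>

type_synonym ('h, 'k) tensor = "('h list \<Rightarrow>\<^sub>0 'k) set"

inductive_set tensor_null ::
    "('k::{comm_ring, comm_monoid_mult} \<Rightarrow> 'h::ab_group_add \<Rightarrow> 'h) \<Rightarrow> nat \<Rightarrow> ('h list \<Rightarrow>\<^sub>0 'k) set"
  for s n where
  additive: "length us + 1 + length vs = n \<Longrightarrow>
    Poly_Mapping.single (us @ [a + b] @ vs) 1 - Poly_Mapping.single (us @ [a] @ vs) 1
      - Poly_Mapping.single (us @ [b] @ vs) 1 \<in> tensor_null s n"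
| homogeneous: "length us + 1 + length vs = n \<Longrightarrow>
    Poly_Mapping.single (us @ [s c a] @ vs) 1
      - fscale c (Poly_Mapping.single (us @ [a] @ vs) 1) \<in> tensor_null s n"
| zero: "0 \<in> tensor_null s n"
| add: "x \<in> tensor_null s n \<Longrightarrow> y \<in> tensor_null s n \<Longrightarrow> x + y \<in> tensor_null s n"
| scale: "x \<in> tensor_null s n \<Longrightarrow> fscale c x \<in> tensor_null s n"

definition formal_tensors :: "nat \<Rightarrow> ('h list \<Rightarrow>\<^sub>0 'k::zero) set" where
  "formal_tensors n = {x. \<forall>xs\<in>Poly_Mapping.keys x. length xs = n}"

definition tclass ::
    "('k::{comm_ring, comm_monoid_mult} \<Rightarrow> 'h::ab_group_add \<Rightarrow> 'h) \<Rightarrow> nat \<Rightarrow> ('h list \<Rightarrow>\<^sub>0 'k)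
      \<Rightarrow> ('h, 'k) tensor" where
  "tclass s n x = {y \<in> formal_tensors n. y - x \<in> tensor_null s n}"

definition tensor_power ::
    "('k::{comm_ring, comm_monoid_mult} \<Rightarrow> 'h::ab_group_add \<Rightarrow> 'h) \<Rightarrow> nat \<Rightarrow> ('h, 'k) tensor set" where
  "tensor_power s n = tclass s n ` formal_tensors n"

definition trep :: "('h, 'k::zero) tensor \<Rightarrow> ('h list \<Rightarrow>\<^sub>0 'k)" where
  "trep A = (SOME x. x \<in> A)"

definition tpure ::
    "('k::{comm_ring, comm_monoid_mult} \<Rightarrow> 'h::ab_group_add \<Rightarrow> 'h) \<Rightarrow> 'h list \<Rightarrow> ('h, 'k) tensor" where
  "tpure s xs = tclass s (length xs) (Poly_Mapping.single xs 1)"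

definition tadd ::
    "('k::{comm_ring, comm_monoid_mult} \<Rightarrow> 'h::ab_group_add \<Rightarrow> 'h) \<Rightarrow> nat
      \<Rightarrow> ('h, 'k) tensor \<Rightarrow> ('h, 'k) tensor \<Rightarrow> ('h, 'k) tensor" where
  "tadd s n A B = tclass s n (trep A + trep B)"

definition tscale ::
    "('k::{comm_ring, comm_monoid_mult} \<Rightarrow> 'h::ab_group_add \<Rightarrow> 'h) \<Rightarrow> nat
      \<Rightarrow> 'k \<Rightarrow> ('h, 'k) tensor \<Rightarrow> ('h, 'k) tensor" where
  "tscale s n c A = tclass s n (fscale c (trep A))"

text \<open>For a multilinear \<open>f\<close>, \<open>tlift s f\<close> is the linear map from a tensor power to the module
  with scalar multiplication \<open>s\<close> that is induced by \<open>f\<close>; it does not depend on the choice of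
  representatives made by \<open>trep\<close>. The same applies to all operations below that use \<open>trep\<close>.\<close>

definition tlift ::
    "('k::{comm_ring, comm_monoid_mult} \<Rightarrow> 'v::ab_group_add \<Rightarrow> 'v) \<Rightarrow> ('h list \<Rightarrow> 'v)
      \<Rightarrow> ('h, 'k) tensor \<Rightarrow> 'v" where
  "tlift s f A = lin_ext s f (trep A)"

text \<open>\<open>tensor_maps s [f\<^sub>1, \<dots>, f\<^sub>n]\<close> is the tensor product of the linear endomorphisms \<open>f\<^sub>i\<close>.\<close>

definition tensor_maps ::
    "('k::{comm_ring, comm_monoid_mult} \<Rightarrow> 'h::ab_group_add \<Rightarrow> 'h) \<Rightarrow> ('h \<Rightarrow> 'h) list
      \<Rightarrow> ('h, 'k) tensor \<Rightarrow> ('h, 'k) tensor" where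
  "tensor_maps s fs A = tclass s (length fs)
     (lin_ext fscale (\<lambda>xs. Poly_Mapping.single (map2 (\<lambda>f x. f x) fs xs) 1) (trep A))"

text \<open>\<open>tensor_two s a b f g\<close> is the tensor product of a linear map \<open>f\<close> into the tensor power of
  degree \<open>a\<close> with a linear map \<open>g\<close> into the tensor power of degree \<open>b\<close>.\<close>

definition formal_append ::
    "('h list \<Rightarrow>\<^sub>0 'k::{comm_ring, comm_monoid_mult}) \<Rightarrow> ('h list \<Rightarrow>\<^sub>0 'k) \<Rightarrow> ('h list \<Rightarrow>\<^sub>0 'k)" where
  "formal_append x y =
     lin_ext fscale (\<lambda>us. lin_ext fscale (\<lambda>vs. Poly_Mapping.single (us @ vs) 1) y) x"

definition tensor_two ::
    "('k::{comm_ring, comm_monoid_mult} \<Rightarrow> 'h::ab_group_add \<Rightarrow> 'h) \<Rightarrow> nat \<Rightarrow> nat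
      \<Rightarrow> ('h \<Rightarrow> ('h, 'k) tensor) \<Rightarrow> ('h \<Rightarrow> ('h, 'k) tensor) \<Rightarrow> ('h, 'k) tensor \<Rightarrow> ('h, 'k) tensor" where
  "tensor_two s a b f g A = tclass s (a + b)
     (lin_ext fscale (\<lambda>xs. formal_append (trep (f (xs ! 0))) (trep (g (xs ! 1)))) (trep A))"

text \<open>The multiplication \<open>(x \<otimes> y) (x' \<otimes> y') = x x' \<otimes> y y'\<close> of the tensor square, without signs.\<close>

definition tmult ::
    "('k::{comm_ring, comm_monoid_mult} \<Rightarrow> 'h::ring \<Rightarrow> 'h)
      \<Rightarrow> ('h, 'k) tensor \<Rightarrow> ('h, 'k) tensor \<Rightarrow> ('h, 'k) tensor" where
  "tmult s A B = tclass s 2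
     (lin_ext fscale (\<lambda>xs. lin_ext fscale (\<lambda>ys. Poly_Mapping.single (map2 (*) xs ys) 1) (trep B)) (trep A))"

text \<open>The left action of a permutation \<open>\<sigma>\<close> of \<open>{1..k}\<close>: position \<open>i\<close> of the result carries the
  entry at position \<open>\<sigma>\<^sup>-\<^sup>1(i)\<close>.\<close>

definition perm_act ::
    "('k::{comm_ring, comm_monoid_mult} \<Rightarrow> 'h::ab_group_add \<Rightarrow> 'h) \<Rightarrow> nat \<Rightarrow> (nat \<Rightarrow> nat)
      \<Rightarrow> ('h, 'k) tensor \<Rightarrow> ('h, 'k) tensor" where
  "perm_act s k \<sigma> A = tclass s k
     (lin_ext fscale (\<lambda>xs. Poly_Mapping.single (map (\<lambda>i. xs ! (inv \<sigma> i - 1)) [1..<k + 1]) 1) (trep A))"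

section \<open>Connected graded bialgebras\<close>

text \<open>\<open>\<G> n\<close> is the homogeneous component of degree \<open>n\<close>.\<close>

definition decomposes :: "(nat \<Rightarrow> 'h::ab_group_add set) \<Rightarrow> 'h \<Rightarrow> (nat \<Rightarrow> 'h) \<Rightarrow> bool" where
  "decomposes \<G> x f \<longleftrightarrow> (\<forall>n. f n \<in> \<G> n) \<and> finite {n. f n \<noteq> 0} \<and> x = (\<Sum>n | f n \<noteq> 0. f n)"

definition hproj :: "(nat \<Rightarrow> 'h::ab_group_add set) \<Rightarrow> nat \<Rightarrow> 'h \<Rightarrow> 'h" where
  "hproj \<G> n x = (THE f. decomposes \<G> x f) n"

locale graded_module = unital_module s
  for s :: "'k::{comm_ring, comm_monoid_mult} \<Rightarrow> 'h::ab_group_add \<Rightarrow> 'h"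
    and \<G> :: "nat \<Rightarrow> 'h set" +
  assumes component_zero: "0 \<in> \<G> n"
    and component_add: "x \<in> \<G> n \<Longrightarrow> y \<in> \<G> n \<Longrightarrow> x + y \<in> \<G> n"
    and component_scale: "x \<in> \<G> n \<Longrightarrow> s c x \<in> \<G> n"
    and direct_sum: "\<exists>!f. decomposes \<G> x f"

locale unital_algebra = unital_module s
  for s :: "'k::{comm_ring, comm_monoid_mult} \<Rightarrow> 'h::{ring, monoid_mult} \<Rightarrow> 'h" +
  assumes scale_mult_left: "s c x * y = s c (x * y)"
    and scale_mult_right: "x * s c y = s c (x * y)"

locale counital_coalgebra = unital_module s
  for s :: "'k::{comm_ring, comm_monoid_mult} \<Rightarrow> 'h::ab_group_add \<Rightarrow> 'h"
    and \<Delta> :: "'h \<Rightarrow> ('h, 'k) tensor"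
    and \<epsilon> :: "'h \<Rightarrow> 'k" +
  assumes comult_closed: "\<Delta> x \<in> tensor_power s 2"
    and comult_add: "\<Delta> (x + y) = tadd s 2 (\<Delta> x) (\<Delta> y)"
    and comult_scale: "\<Delta> (s c x) = tscale s 2 c (\<Delta> x)"
    and counit_linear: "linear_map s (*) \<epsilon>"
    and coassoc: "tensor_two s 2 1 \<Delta> (\<lambda>x. tpure s [x]) (\<Delta> x) = tensor_two s 1 2 (\<lambda>x. tpure s [x]) \<Delta> (\<Delta> x)"
    and counit_left: "tlift s (\<lambda>xs. s (\<epsilon> (xs ! 0)) (xs ! 1)) (\<Delta> x) = x"
    and counit_right: "tlift s (\<lambda>xs. s (\<epsilon> (xs ! 1)) (xs ! 0)) (\<Delta> x) = x"

locale bialgebra = unital_algebra s + counital_coalgebra s \<Delta> \<epsilon>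
  for s :: "'k::{comm_ring, comm_monoid_mult} \<Rightarrow> 'h::{ring, monoid_mult} \<Rightarrow> 'h"
    and \<Delta> :: "'h \<Rightarrow> ('h, 'k) tensor"
    and \<epsilon> :: "'h \<Rightarrow> 'k" +
  assumes comult_mult: "\<Delta> (x * y) = tmult s (\<Delta> x) (\<Delta> y)"
    and comult_one: "\<Delta> 1 = tpure s [1, 1]"
    and counit_mult: "\<epsilon> (x * y) = \<epsilon> x * \<epsilon> y"
    and counit_one: "\<epsilon> 1 = 1"

text \<open>Axiom \<open>graded_comult\<close>: the comultiplication sends degree \<open>n\<close> to the sum of the images of
  \<open>\<G> i \<otimes> \<G> j\<close> over \<open>i + j = n\<close>.\<close>

locale connected_graded_bialgebra = bialgebra s \<Delta> \<epsilon> + graded_module s \<G>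
  for s :: "'k::{comm_ring, comm_monoid_mult} \<Rightarrow> 'h::{ring, monoid_mult} \<Rightarrow> 'h"
    and \<Delta> :: "'h \<Rightarrow> ('h, 'k) tensor"
    and \<epsilon> :: "'h \<Rightarrow> 'k"
    and \<G> :: "nat \<Rightarrow> 'h set" +
  assumes graded_mult: "x \<in> \<G> i \<Longrightarrow> y \<in> \<G> j \<Longrightarrow> x * y \<in> \<G> (i + j)"
    and graded_one: "1 \<in> \<G> 0"
    and graded_comult: "x \<in> \<G> n \<Longrightarrow>
      \<Delta> x \<in> {tclass s 2 z | z. Poly_Mapping.keys z \<subseteq> {[a, b] | a b i j. i + j = n \<and> a \<in> \<G> i \<and> b \<in> \<G> j}}"
    and graded_counit: "x \<in> \<G> n \<Longrightarrow> n \<noteq> 0 \<Longrightarrow> \<epsilon> x = 0"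
    and connected: "\<G> 0 = range (\<lambda>c. s c 1)"

text \<open>Iterated comultiplication and multiplication. On the tensor power of degree 0, spanned by
  the empty list, the latter is the unit map.\<close>

primrec iter_comult ::
    "('k::{comm_ring, comm_monoid_mult} \<Rightarrow> 'h::ab_group_add \<Rightarrow> 'h) \<Rightarrow> ('h \<Rightarrow> ('h, 'k) tensor) \<Rightarrow> ('h \<Rightarrow> 'k)
      \<Rightarrow> nat \<Rightarrow> 'h \<Rightarrow> ('h, 'k) tensor" where
  "iter_comult s \<Delta> \<epsilon> 0 = (\<lambda>x. tclass s 0 (Poly_Mapping.single [] (\<epsilon> x)))"
| "iter_comult s \<Delta> \<epsilon> (Suc k) =
     (\<lambda>x. tensor_two s 1 k (\<lambda>y. tpure s [y]) (iter_comult s \<Delta> \<epsilon> k) (\<Delta> x))"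

definition iter_mult ::
    "('k::{comm_ring, comm_monoid_mult} \<Rightarrow> 'h::{ring, monoid_mult} \<Rightarrow> 'h) \<Rightarrow> ('h, 'k) tensor \<Rightarrow> 'h" where
  "iter_mult s = tlift s prod_list"

definition p_map ::
    "('k::{comm_ring, comm_monoid_mult} \<Rightarrow> 'h::{ring, monoid_mult} \<Rightarrow> 'h) \<Rightarrow> ('h \<Rightarrow> ('h, 'k) tensor)
      \<Rightarrow> ('h \<Rightarrow> 'k) \<Rightarrow> (nat \<Rightarrow> 'h set) \<Rightarrow> nat list \<Rightarrow> (nat \<Rightarrow> nat) \<Rightarrow> 'h \<Rightarrow> 'h" where
  "p_map s \<Delta> \<epsilon> \<G> \<alpha> \<sigma> = iter_mult s \<circ> tensor_maps s (map (hproj \<G>) \<alpha>)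
     \<circ> perm_act s (length \<alpha>) (inv \<sigma>) \<circ> iter_comult s \<Delta> \<epsilon> (length \<alpha>)"

definition convolution ::
    "('k::{comm_ring, comm_monoid_mult} \<Rightarrow> 'h::{ring, monoid_mult} \<Rightarrow> 'h) \<Rightarrow> ('h \<Rightarrow> ('h, 'k) tensor)
      \<Rightarrow> ('h \<Rightarrow> 'h) \<Rightarrow> ('h \<Rightarrow> 'h) \<Rightarrow> 'h \<Rightarrow> 'h" where
  "convolution s \<Delta> f g = tlift s (\<lambda>xs. xs ! 0 * xs ! 1) \<circ> tensor_maps s [f, g] \<circ> \<Delta>"

section \<open>Mopiscotions\<close>

text \<open>Permutations of \<open>{1..k}\<close> are functions on \<open>nat\<close> fixing everything outside \<open>{1..k}\<close>. As
  lists are indexed from 0, the \<open>i\<close>-th entry of a tuple \<open>\<alpha>\<close> is \<open>\<alpha> ! (i - 1)\<close>.\<close>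

definition weak_mopiscotion :: "nat list \<Rightarrow> (nat \<Rightarrow> nat) \<Rightarrow> bool" where
  "weak_mopiscotion \<alpha> \<sigma> \<longleftrightarrow> \<sigma> permutes {1..length \<alpha>}"

typedef mopiscotion = "{(\<alpha>, \<sigma>). weak_mopiscotion \<alpha> \<sigma> \<and> 0 \<notin> set \<alpha>}"
proof
  show "([], id) \<in> {(\<alpha>, \<sigma>). weak_mopiscotion \<alpha> \<sigma> \<and> 0 \<notin> set \<alpha>}"
    by (simp add: weak_mopiscotion_def permutes_id)
qed

definition standardization :: "'a::linorder list \<Rightarrow> nat \<Rightarrow> nat" where
  "standardization w = (THE \<sigma>. \<sigma> permutes {1..length w} \<and>
     (\<forall>a b. 1 \<le> a \<and> a < b \<and> b \<le> length w \<longrightarrow> (\<sigma> a < \<sigma> b \<longleftrightarrow> w ! (a - 1) \<le> w ! (b - 1))))"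

definition red :: "nat list \<Rightarrow> (nat \<Rightarrow> nat) \<Rightarrow> mopiscotion" where
  "red \<alpha> \<sigma> =
     (let js = filter (\<lambda>i. \<alpha> ! (i - 1) \<noteq> 0) [1..<length \<alpha> + 1]
      in Abs_mopiscotion (map (\<lambda>j. \<alpha> ! (j - 1)) js, standardization (map \<sigma> js)))"

definition perm_oplus :: "nat \<Rightarrow> (nat \<Rightarrow> nat) \<Rightarrow> (nat \<Rightarrow> nat) \<Rightarrow> nat \<Rightarrow> nat" where
  "perm_oplus k \<sigma> \<tau> n = (if n \<le> k then \<sigma> n else k + \<tau> (n - k))"

text \<open>The permutation \<open>\<tau>[\<sigma>]\<close> of \<open>{1..k * l}\<close>: here \<open>n = l * (i - 1) + j\<close> with \<open>1 \<le> i \<le> k\<close> and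
  \<open>1 \<le> j \<le> l\<close> means \<open>i = (n - 1) div l + 1\<close> and \<open>j = (n - 1) mod l + 1\<close>.\<close>

definition perm_bracket :: "nat \<Rightarrow> nat \<Rightarrow> (nat \<Rightarrow> nat) \<Rightarrow> (nat \<Rightarrow> nat) \<Rightarrow> nat \<Rightarrow> nat" where
  "perm_bracket k l \<tau> \<sigma> n =
     (if n \<in> {1..k * l}
      then k * (\<tau> ((n - 1) mod l + 1) - 1) + \<sigma> ((n - 1) div l + 1)
      else n)"

section \<open>The algebra PNSym\<close>

type_synonym 'k pnsym = "mopiscotion \<Rightarrow>\<^sub>0 'k"

definition F :: "nat list \<Rightarrow> (nat \<Rightarrow> nat) \<Rightarrow> 'k::{comm_ring, comm_monoid_mult} pnsym" where
  "F \<alpha> \<sigma> = Poly_Mapping.single (red \<alpha> \<sigma>) 1"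

definition bilin_ext ::
    "(nat list \<Rightarrow> (nat \<Rightarrow> nat) \<Rightarrow> nat list \<Rightarrow> (nat \<Rightarrow> nat) \<Rightarrow> 'k pnsym)
      \<Rightarrow> 'k::{comm_ring, comm_monoid_mult} pnsym \<Rightarrow> 'k pnsym \<Rightarrow> 'k pnsym" where
  "bilin_ext f u v =
     lin_ext fscale (\<lambda>a. lin_ext fscale (\<lambda>b.
       (case (Rep_mopiscotion a, Rep_mopiscotion b) of ((\<alpha>, \<sigma>), (\<beta>, \<tau>)) \<Rightarrow> f \<alpha> \<sigma> \<beta> \<tau>)) v) u"

definition ext_mult :: "'k::{comm_ring, comm_monoid_mult} pnsym \<Rightarrow> 'k pnsym \<Rightarrow> 'k pnsym" where
  "ext_mult = bilin_ext (\<lambda>\<alpha> \<sigma> \<beta> \<tau>. F (\<alpha> @ \<beta>) (perm_oplus (length \<alpha>) \<sigma> \<tau>))"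

text \<open>Matrices with row sums \<open>\<alpha>\<close> and column sums \<open>\<beta>\<close>, given as lists of rows; \<open>concat\<close> then
  lists the entries in lexicographic order of their positions.\<close>

definition matrices :: "nat list \<Rightarrow> nat list \<Rightarrow> nat list list set" where
  "matrices \<alpha> \<beta> = {\<gamma>. length \<gamma> = length \<alpha> \<and> (\<forall>i<length \<alpha>. length (\<gamma> ! i) = length \<beta>)
     \<and> (\<forall>i<length \<alpha>. (\<Sum>j<length \<beta>. \<gamma> ! i ! j) = \<alpha> ! i)
     \<and> (\<forall>j<length \<beta>. (\<Sum>i<length \<alpha>. \<gamma> ! i ! j) = \<beta> ! j)}"

definition int_mult :: "'k::{comm_ring, comm_monoid_mult} pnsym \<Rightarrow> 'k pnsym \<Rightarrow> 'k pnsym" where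
  "int_mult = bilin_ext (\<lambda>\<alpha> \<sigma> \<beta> \<tau>.
     \<Sum>\<gamma>\<in>matrices \<alpha> \<beta>. F (concat \<gamma>) (perm_bracket (length \<alpha>) (length \<beta>) \<tau> \<sigma>))"

section \<open>Modules over non-unital algebras\<close>

text \<open>\<open>act\<close> makes the module with scalar multiplication \<open>s\<close> a module over the non-unital algebra
  with scalar multiplication \<open>t\<close> and multiplication \<open>mul\<close>.\<close>

definition nonunital_module ::
    "('k::{comm_ring, comm_monoid_mult} \<Rightarrow> 'a::ab_group_add \<Rightarrow> 'a) \<Rightarrow> ('a \<Rightarrow> 'a \<Rightarrow> 'a)
      \<Rightarrow> ('k \<Rightarrow> 'h::ab_group_add \<Rightarrow> 'h) \<Rightarrow> ('a \<Rightarrow> 'h \<Rightarrow> 'h) \<Rightarrow> bool" where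
  "nonunital_module t mul s act \<longleftrightarrow> unital_module s
     \<and> (\<forall>a. linear_map s s (act a)) \<and> (\<forall>h. linear_map t s (\<lambda>a. act a h))
     \<and> (\<forall>a b h. act (mul a b) h = act a (act b h))"

end

theory Submission
  imports Defs
begin

text \<open>
  All maps in question are evaluations of multilinear maps on iterated comultiplications, so the
  tensor powers can be replaced by Sweedler sums, for which coassociativity, multiplicativity of
  \<open>\<Delta>\<close> and compatibility with the grading become identities between nested sums. In degree 0 the
  projection is \<open>x \<mapsto> \<epsilon>(x) 1\<close> by connectedness; hence a zero entry of \<open>\<alpha>\<close> contracts one tensor
  factor, and \<open>p\<^sub>\<alpha>\<^sub>,\<^sub>\<sigma>\<close> is unchanged by reduction. For the internal product, expand
  \<open>p\<^sub>\<alpha>\<^sub>,\<^sub>\<sigma>\<close> on the product defining \<open>p\<^sub>\<beta>\<^sub>,\<^sub>\<tau>\<close>: \<open>\<Delta>\<close> of a product is the product of the \<open>\<Delta>\<close>'s,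
  and each projection to degree \<open>\<alpha>\<^sub>i\<close> splits over its factors into degrees \<open>\<gamma>\<^sub>i\<^sub>j\<close>. The projections
  to the degrees \<open>\<beta>\<^sub>j\<close> then only keep the matrices with column sums \<open>\<beta>\<close>.
\<close>

section \<open>Linear and multilinear maps\<close>

text \<open>The permutation \<tau>[\<sigma>] records a change of reading order. When h is cut into l
  parts and each part into k parts, the k * l factors come grouped by the part of h they belong to,
  whereas the composite multiplies them grouped by the k slots of \<alpha>. The obstacle is that
  tensors are cosets and every evaluation goes through an arbitrarily chosen representative.
  Exchanging nested sums and pulling linear maps through them are facts about finite sums. A
  bialgebra axiom, however, equates cosets, so evaluating a function on both sides of it requires
  multilinearity; hence a multilinearity lemma accompanies almost every nested sum.

  The entry above is malformed and is to be discarded; the complete list follows.\<close>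

lemma linear_mapI:
  assumes "\<And>x y. f (x + y) = f x + f y" and "\<And>c x. f (s c x) = t c (f x)"
  shows "linear_map s t f"
  using assms by (simp add: linear_map_def)

lemma linear_map_add: "linear_map s t f \<Longrightarrow> f (x + y) = f x + f y"
  and linear_map_scale: "linear_map s t f \<Longrightarrow> f (s c x) = t c (f x)"
  by (simp_all add: linear_map_def)

lemma linear_map_zero: "linear_map s t f \<Longrightarrow> f 0 = 0"
  using linear_map_add[of s t f 0 0] by simp

lemma linear_map_sum: "linear_map s t f \<Longrightarrow> f (sum g A) = (\<Sum>a\<in>A. f (g a))"
  by (induction A rule: infinite_finite_induct) (simp_all add: linear_map_zero linear_map_add)

lemma linear_map_diff:
  assumes "linear_map s t f"
  shows "f (x - y) = f x - f y"
  using linear_map_add[OF assms, of "x - y" y] by (simp add: algebra_simps)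

lemma linear_map_id: "linear_map s s (\<lambda>x. x)"
  by (simp add: linear_map_def)

lemma linear_map_comp:
  "linear_map t u g \<Longrightarrow> linear_map s t f \<Longrightarrow> linear_map s u (\<lambda>x. g (f x))"
  by (simp add: linear_map_def)

lemma linear_map_lin_ext:
  "linear_map t u L \<Longrightarrow> L (lin_ext t g x) = lin_ext u (\<lambda>b. L (g b)) x"
  by (simp add: lin_ext_def linear_map_sum linear_map_scale)

lemma lin_ext_cong:
  "(\<And>b. b \<in> Poly_Mapping.keys x \<Longrightarrow> f b = g b) \<Longrightarrow> lin_ext t f x = lin_ext t g x"
  by (simp add: lin_ext_def)

lemma lookup_fscale: "Poly_Mapping.lookup (fscale c x) b = c * Poly_Mapping.lookup x b"
  by (simp add: fscale_def Poly_Mapping.map.rep_eq when_def)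

lemma keys_fscale: "Poly_Mapping.keys (fscale c x) \<subseteq> Poly_Mapping.keys x"
  by (auto simp: in_keys_iff lookup_fscale)

context unital_module
begin

lemma scale_zero_right [simp]: "scale c 0 = 0"
  using scale_right_distrib[of c 0 0] by simp

lemma scale_zero_left [simp]: "scale 0 x = 0"
  using scale_left_distrib[of 0 0 x] by simp

lemma scale_sum_right: "scale c (sum f A) = (\<Sum>a\<in>A. scale c (f a))"
  by (induction A rule: infinite_finite_induct) (simp_all add: scale_right_distrib)

lemma scale_commute: "scale c (scale d x) = scale d (scale c x)"
  by (simp add: scale_scale mult.commute)

lemma linear_map_scale_const: "linear_map scale scale (scale c)"
  by (intro linear_mapI) (simp_all add: scale_right_distrib scale_commute)

lemma linear_map_scale_image: "linear_map t scale f \<Longrightarrow> linear_map t scale (\<lambda>x. scale c (f x))"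
  by (rule linear_map_comp[OF linear_map_scale_const])

lemma linear_map_zero_const: "linear_map t scale (\<lambda>_. 0)"
  by (simp add: linear_map_def)

lemma linear_map_scale_coeff: "linear_map t (*) e \<Longrightarrow> linear_map t scale (\<lambda>x. scale (e x) v)"
  by (simp add: linear_map_def scale_left_distrib scale_scale)

lemma linear_map_sum_image:
  "(\<And>a. a \<in> A \<Longrightarrow> linear_map t scale (f a)) \<Longrightarrow> linear_map t scale (\<lambda>x. \<Sum>a\<in>A. f a x)"
  by (simp add: linear_map_def sum.distrib scale_sum_right)

text \<open>Coefficients may cancel, so the supports of x, y and x + y differ; summing over a common
  finite superset makes additivity a termwise statement.\<close>

lemma lin_ext_superset:
  assumes "finite A" "Poly_Mapping.keys x \<subseteq> A"
  shows "lin_ext scale f x = (\<Sum>b\<in>A. scale (Poly_Mapping.lookup x b) (f b))"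
  unfolding lin_ext_def
  by (rule sum.mono_neutral_left) (use assms in \<open>auto simp: in_keys_iff\<close>)

lemma lin_ext_add: "lin_ext scale f (x + y) = lin_ext scale f x + lin_ext scale f y"
proof -
  let ?A = "Poly_Mapping.keys x \<union> Poly_Mapping.keys y"
  have "lin_ext scale f z = (\<Sum>b\<in>?A. scale (Poly_Mapping.lookup z b) (f b))"
    if "z \<in> {x, y, x + y}" for z
    using that keys_add[of x y] by (intro lin_ext_superset) auto
  then show ?thesis
    by (simp add: lookup_add scale_left_distrib sum.distrib)
qed

lemma lin_ext_fscale: "lin_ext scale f (fscale c x) = scale c (lin_ext scale f x)"
  using lin_ext_superset[OF finite_keys keys_fscale, of f c x]
  by (simp add: lookup_fscale scale_sum_right scale_scale lin_ext_def)

lemma linear_map_lin_ext_arg: "linear_map fscale scale (lin_ext scale f)"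
  by (intro linear_mapI lin_ext_add lin_ext_fscale)

lemma lin_ext_diff: "lin_ext scale f (x - y) = lin_ext scale f x - lin_ext scale f y"
  by (rule linear_map_diff[OF linear_map_lin_ext_arg])

lemma lin_ext_single: "lin_ext scale f (Poly_Mapping.single b c) = scale c (f b)"
  using lin_ext_superset[of "{b}" "Poly_Mapping.single b c" f] by simp

lemma lin_ext_lin_ext: "lin_ext scale f (lin_ext fscale g x) = lin_ext scale (\<lambda>b. lin_ext scale f (g b)) x"
  by (rule linear_map_lin_ext[OF linear_map_lin_ext_arg])

lemma lin_ext_swap:
  "lin_ext scale (\<lambda>a. lin_ext scale (\<lambda>b. f a b) y) x = lin_ext scale (\<lambda>b. lin_ext scale (\<lambda>a. f a b) x) y"
  unfolding lin_ext_def scale_sum_right scale_commute by (rule sum.swap)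

lemma linear_map_lin_ext_fun:
  "(\<And>b. b \<in> Poly_Mapping.keys x \<Longrightarrow> linear_map t scale (\<lambda>a. f a b)) \<Longrightarrow> linear_map t scale (\<lambda>a. lin_ext scale (f a) x)"
  unfolding lin_ext_def by (intro linear_map_sum_image linear_map_scale_image)

section \<open>Multilinear functions of lists\<close>

definition multilinear :: "nat \<Rightarrow> ('v list \<Rightarrow> 'v) \<Rightarrow> bool" where
  "multilinear n f \<longleftrightarrow>
     (\<forall>xs i. length xs = n \<longrightarrow> i < n \<longrightarrow> linear_map scale scale (\<lambda>a. f (xs[i := a])))"

lemma multilinearI:
  "(\<And>xs i. length xs = n \<Longrightarrow> i < n \<Longrightarrow> linear_map scale scale (\<lambda>a. f (xs[i := a]))) \<Longrightarrow> multilinear n f"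
  by (simp add: multilinear_def)

lemma multilinearD:
  "multilinear n f \<Longrightarrow> length xs = n \<Longrightarrow> i < n \<Longrightarrow> linear_map scale scale (\<lambda>a. f (xs[i := a]))"
  by (simp add: multilinear_def)

lemma multilinear_cong:
  assumes "multilinear n f" "\<And>xs. length xs = n \<Longrightarrow> g xs = f xs"
  shows "multilinear n g"
  using assms by (simp add: multilinear_def)

lemma multilinear_Cons:
  assumes "multilinear (Suc n) f"
  shows "multilinear n (\<lambda>xs. f (a # xs))"
proof (rule multilinearI)
  fix xs :: "'v list" and i
  assume "length xs = n" "i < n"
  then show "linear_map scale scale (\<lambda>b. f (a # xs[i := b]))"
    using multilinearD[OF assms, of "a # xs" "Suc i"] by simp
qed

lemma multilinear_head:
  assumes "multilinear (Suc n) f" "length xs = n"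
  shows "linear_map scale scale (\<lambda>a. f (a # xs))"
  using multilinearD[OF assms(1), of "0 # xs" 0] assms(2) by simp

lemma multilinear_append_left: "multilinear (m + n) f \<Longrightarrow> length ys = n \<Longrightarrow> multilinear m (\<lambda>xs. f (xs @ ys))"
  by (rule multilinearI) (auto simp flip: list_update_append1 intro!: multilinearD[of "m + n" f])

lemma multilinear_append_right:
  assumes "multilinear (m + n) f" "length xs = m"
  shows "multilinear n (\<lambda>ys. f (xs @ ys))"
proof (rule multilinearI)
  fix ys :: "'v list" and i
  assume "length ys = n" "i < n"
  then show "linear_map scale scale (\<lambda>a. f (xs @ ys[i := a]))"
    using multilinearD[OF assms(1), of "xs @ ys" "m + i"] assms(2) by (simp add: list_update_append)
qed

lemma multilinear_ConsI:
  assumes "\<And>xs. length xs = n \<Longrightarrow> linear_map scale scale (\<lambda>a. f (a # xs))" "\<And>a. multilinear n (\<lambda>xs. f (a # xs))"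
  shows "multilinear (Suc n) f"
proof (rule multilinearI)
  fix xs :: "'v list" and i
  assume *: "length xs = Suc n" "i < Suc n"
  obtain y ys where xs: "xs = y # ys" using *(1) by (cases xs) auto
  show "linear_map scale scale (\<lambda>a. f (xs[i := a]))"
  proof (cases i)
    case 0
    then show ?thesis using assms(1) xs * by simp
  next
    case (Suc j)
    then show ?thesis using multilinearD[OF assms(2), of ys j y] xs * by simp
  qed
qed

lemma multilinear_lin_ext_fun:
  "(\<And>b. b \<in> Poly_Mapping.keys y \<Longrightarrow> multilinear n (\<lambda>xs. f xs b)) \<Longrightarrow> multilinear n (\<lambda>xs. lin_ext scale (f xs) y)"
  by (rule multilinearI) (intro linear_map_lin_ext_fun, simp add: multilinear_def)

lemma multilinear_permute:
  assumes f: "multilinear n f" and \<rho>: "\<rho> permutes {..<n}"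
  shows "multilinear n (\<lambda>xs. f (map (\<lambda>i. xs ! \<rho> i) [0..<n]))"
proof (rule multilinearI)
  fix xs :: "'v list" and i
  assume *: "length xs = n" "i < n"
  \<comment> \<open>Slot i of \<open>xs\<close> is read only by slot \<open>inv \<rho> i\<close> of
    the permuted list, so updating one entry before permuting updates one entry afterwards.\<close>
  define j where "j = inv \<rho> i"
  have j: "j < n" "\<rho> j = i"
    using permutes_inv[OF \<rho>] *(2) permutes_in_image[of "inv \<rho>" "{..<n}" i] \<rho>
    by (auto simp: j_def permutes_inverses)
  have "map (\<lambda>m. xs[i := a] ! \<rho> m) [0..<n] = (map (\<lambda>m. xs ! \<rho> m) [0..<n])[j := a]" for a
  proof (rule nth_equalityI)
    fix m assume m: "m < length (map (\<lambda>m. xs[i := a] ! \<rho> m) [0..<n])"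
    have "\<rho> m = i \<longleftrightarrow> m = j" using j inj_eq[OF permutes_inj[OF \<rho>]] by metis
    then show "map (\<lambda>m. xs[i := a] ! \<rho> m) [0..<n] ! m = (map (\<lambda>m. xs ! \<rho> m) [0..<n])[j := a] ! m"
      using m * j by (auto simp: nth_list_update)
  qed simp
  then show "linear_map scale scale (\<lambda>a. f (map (\<lambda>m. xs[i := a] ! \<rho> m) [0..<n]))"
    using multilinearD[OF f, of "map (\<lambda>m. xs ! \<rho> m) [0..<n]" j] j by simp
qed

lemma map2_list_update:
  assumes "length fs = length xs" "i < length xs"
  shows "map2 g fs (xs[i := a]) = (map2 g fs xs)[i := g (fs ! i) a]"
  by (rule nth_equalityI) (use assms in \<open>auto simp: nth_list_update\<close>)

lemma multilinear_map2:
  assumes f: "multilinear n f" and "length cs = n" "\<And>c. c \<in> set cs \<Longrightarrow> linear_map scale scale (g c)"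
  shows "multilinear n (\<lambda>xs. f (map2 g cs xs))"
proof (rule multilinearI)
  fix xs :: "'v list" and i
  assume *: "length xs = n" "i < n"
  have "linear_map scale scale (\<lambda>a. f ((map2 g cs xs)[i := g (cs ! i) a]))"
    by (rule linear_map_comp[OF multilinearD[OF f] assms(3)]) (use * assms in auto)
  then show "linear_map scale scale (\<lambda>a. f (map2 g cs (xs[i := a])))"
    using * assms by (simp add: map2_list_update)
qed

end

lemma (in unital_algebra) linear_map_mult_left: "linear_map s s f \<Longrightarrow> linear_map s s (\<lambda>x. f x * c)"
  and linear_map_mult_right: "linear_map s s f \<Longrightarrow> linear_map s s (\<lambda>x. c * f x)"
  by (simp_all add: linear_map_def algebra_simps scale_mult_left scale_mult_right)

section \<open>Tensor powers\<close>

lemma formal_tensors_lin_ext: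
  assumes "\<And>b. b \<in> Poly_Mapping.keys x \<Longrightarrow> g b \<in> formal_tensors n"
  shows "lin_ext fscale g x \<in> formal_tensors n"
proof -
  have "Poly_Mapping.keys (lin_ext fscale g x) \<subseteq> (\<Union>b\<in>Poly_Mapping.keys x. Poly_Mapping.keys (g b))"
    unfolding lin_ext_def using keys_fscale by (intro order_trans[OF keys_sum]) fastforce
  then show ?thesis using assms by (fastforce simp: formal_tensors_def)
qed

lemma formal_tensors_single: "length xs = n \<Longrightarrow> Poly_Mapping.single xs c \<in> formal_tensors n"
  by (simp add: formal_tensors_def)

lemma formal_tensors_add: "x \<in> formal_tensors n \<Longrightarrow> y \<in> formal_tensors n \<Longrightarrow> x + y \<in> formal_tensors n"
  using keys_add[of x y] by (auto simp: formal_tensors_def)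

lemma formal_tensors_fscale: "x \<in> formal_tensors n \<Longrightarrow> fscale c x \<in> formal_tensors n"
  using keys_fscale[of c x] by (auto simp: formal_tensors_def)

lemma formal_tensorsD: "x \<in> formal_tensors n \<Longrightarrow> xs \<in> Poly_Mapping.keys x \<Longrightarrow> length xs = n"
  by (simp add: formal_tensors_def)

lemma formal_append_formal_tensors:
  "x \<in> formal_tensors m \<Longrightarrow> y \<in> formal_tensors n \<Longrightarrow> formal_append x y \<in> formal_tensors (m + n)"
  unfolding formal_append_def
  by (intro formal_tensors_lin_ext formal_tensors_single) (simp add: formal_tensors_def)

lemma trep_tclass:
  assumes "x \<in> formal_tensors n"
  shows "trep (tclass s n x) \<in> formal_tensors n" "trep (tclass s n x) - x \<in> tensor_null s n"
proof -
  have "x \<in> tclass s n x"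
    using assms by (simp add: tclass_def tensor_null.zero)
  then have "trep (tclass s n x) \<in> tclass s n x"
    unfolding trep_def by (rule someI[of "\<lambda>y. y \<in> tclass s n x"])
  then show "trep (tclass s n x) \<in> formal_tensors n" "trep (tclass s n x) - x \<in> tensor_null s n"
    by (simp_all add: tclass_def)
qed

lemma trep_tensor_power: "A \<in> tensor_power s n \<Longrightarrow> trep A \<in> formal_tensors n"
  by (auto simp: tensor_power_def trep_tclass)

lemma tclass_tensor_power: "x \<in> formal_tensors n \<Longrightarrow> tclass s n x \<in> tensor_power s n"
  by (simp add: tensor_power_def)

lemma tpure_tensor_power: "length xs = n \<Longrightarrow> tpure s xs \<in> tensor_power s n"
  by (auto simp: tpure_def intro!: tclass_tensor_power formal_tensors_single)

section \<open>Evaluating multilinear functions on tensors\<close>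

context unital_module
begin

text \<open>A multilinear function kills both kinds of generating relations, and the kernel of its
  linear extension is closed under sums and scalars. This makes evaluation independent of the
  representative picked by \<open>trep\<close>.\<close>

lemma lin_ext_tensor_null:
  assumes "x \<in> tensor_null scale n" "multilinear n f"
  shows "lin_ext scale f x = 0"
  using assms(1)
proof induction
  case (additive us vs a b)
  have "linear_map scale scale (\<lambda>c. f ((us @ [a] @ vs)[length us := c]))"
    by (rule multilinearD[OF assms(2)]) (use additive in auto)
  from linear_map_add[OF this, of a b] show ?case
    by (simp add: lin_ext_diff lin_ext_single scale_one)
next
  case (homogeneous us vs c a)
  have "linear_map scale scale (\<lambda>c. f ((us @ [a] @ vs)[length us := c]))"
    by (rule multilinearD[OF assms(2)]) (use homogeneous in auto)
  from linear_map_scale[OF this, of c a] show ?case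
    by (simp add: lin_ext_diff lin_ext_single lin_ext_fscale scale_one)
qed (simp_all add: lin_ext_def[of scale f 0] lin_ext_add lin_ext_fscale)

lemma tlift_tclass:
  assumes "multilinear n f" "x \<in> formal_tensors n"
  shows "tlift scale f (tclass scale n x) = lin_ext scale f x"
  using lin_ext_tensor_null[OF trep_tclass(2)[OF assms(2)] assms(1)]
  by (simp add: tlift_def lin_ext_diff)

text \<open>Representatives of elements of the n-th tensor power are supported on lists of length n,
  so only the values on such lists enter.\<close>

lemma tlift_cong:
  "A \<in> tensor_power scale n \<Longrightarrow> (\<And>xs. length xs = n \<Longrightarrow> f xs = g xs) \<Longrightarrow> tlift scale f A = tlift scale g A"
  unfolding tlift_def by (rule lin_ext_cong) (simp add: formal_tensorsD[OF trep_tensor_power])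

lemma tlift_tpure:
  "multilinear (length xs) f \<Longrightarrow> tlift scale f (tpure scale xs) = f xs"
  by (simp add: tpure_def tlift_tclass formal_tensors_single lin_ext_single scale_one)

lemma tlift_tadd:
  "multilinear n f \<Longrightarrow> A \<in> tensor_power scale n \<Longrightarrow> B \<in> tensor_power scale n \<Longrightarrow>
    tlift scale f (tadd scale n A B) = tlift scale f A + tlift scale f B"
  by (simp add: tadd_def tlift_tclass formal_tensors_add trep_tensor_power lin_ext_add)
    (simp add: tlift_def)

lemma tlift_tscale:
  "multilinear n f \<Longrightarrow> A \<in> tensor_power scale n \<Longrightarrow> tlift scale f (tscale scale n c A) = scale c (tlift scale f A)"
  by (simp add: tscale_def tlift_tclass formal_tensors_fscale trep_tensor_power lin_ext_fscale)
    (simp add: tlift_def)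

lemma tlift_tclass_lin_ext:
  assumes "multilinear n f" "A \<in> tensor_power scale m" "\<And>xs. length xs = m \<Longrightarrow> g xs \<in> formal_tensors n"
  shows "tlift scale f (tclass scale n (lin_ext fscale g (trep A))) = tlift scale (\<lambda>xs. lin_ext scale f (g xs)) A"
proof -
  have "lin_ext fscale g (trep A) \<in> formal_tensors n"
    using formal_tensorsD[OF trep_tensor_power[OF assms(2)]] assms(3) by (intro formal_tensors_lin_ext) simp
  then show ?thesis
    by (simp add: tlift_tclass assms(1) lin_ext_lin_ext) (simp add: tlift_def)
qed

lemma tensor_power_lin_ext:
  assumes "A \<in> tensor_power scale m" "\<And>xs. length xs = m \<Longrightarrow> g xs \<in> formal_tensors n"
  shows "tclass scale n (lin_ext fscale g (trep A)) \<in> tensor_power scale n"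
  using formal_tensorsD[OF trep_tensor_power[OF assms(1)]] assms(2)
  by (intro tclass_tensor_power formal_tensors_lin_ext) simp

lemma tlift_tensor_maps:
  assumes "multilinear (length fs) f" "A \<in> tensor_power scale (length fs)"
  shows "tlift scale f (tensor_maps scale fs A) = tlift scale (\<lambda>xs. f (map2 (\<lambda>f x. f x) fs xs)) A"
  unfolding tensor_maps_def using assms
  by (subst tlift_tclass_lin_ext) (auto intro: formal_tensors_single simp: lin_ext_single scale_one)

lemma tensor_power_perm_act:
  "A \<in> tensor_power scale k \<Longrightarrow> perm_act scale k \<sigma> A \<in> tensor_power scale k"
  unfolding perm_act_def by (rule tensor_power_lin_ext) (auto simp: formal_tensors_def)

lemma tlift_perm_act:
  assumes "multilinear k f" "A \<in> tensor_power scale k"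
  shows "tlift scale f (perm_act scale k \<sigma> A) = tlift scale (\<lambda>xs. f (map (\<lambda>i. xs ! (inv \<sigma> i - 1)) [1..<k + 1])) A"
  unfolding perm_act_def using assms
  by (subst tlift_tclass_lin_ext) (auto simp: formal_tensors_def lin_ext_single scale_one)

lemma lin_ext_formal_append:
  "lin_ext scale f (formal_append x y) = lin_ext scale (\<lambda>us. lin_ext scale (\<lambda>vs. f (us @ vs)) y) x"
  by (simp add: formal_append_def lin_ext_lin_ext lin_ext_single scale_one)

lemma tensor_power_tensor_two:
  assumes "A \<in> tensor_power scale 2" "\<And>x. f x \<in> tensor_power scale m" "\<And>x. g x \<in> tensor_power scale n"
  shows "tensor_two scale m n f g A \<in> tensor_power scale (m + n)"
  unfolding tensor_two_def using assms
  by (intro tensor_power_lin_ext formal_append_formal_tensors trep_tensor_power)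

lemma tlift_tensor_two:
  assumes "multilinear (m + n) h" "A \<in> tensor_power scale 2"
    "\<And>x. f x \<in> tensor_power scale m" "\<And>x. g x \<in> tensor_power scale n"
  shows "tlift scale h (tensor_two scale m n f g A) =
    tlift scale (\<lambda>xs. tlift scale (\<lambda>us. tlift scale (\<lambda>vs. h (us @ vs)) (g (xs ! 1))) (f (xs ! 0))) A"
  unfolding tensor_two_def using assms
  by (subst tlift_tclass_lin_ext)
    (auto intro!: formal_append_formal_tensors trep_tensor_power simp: lin_ext_formal_append tlift_def)

text \<open>Both sides are one finite double sum over the representatives chosen for
  \<open>A\<close> and \<open>B\<close>, read in two orders.\<close>

lemma tlift_swap:
  "tlift scale (\<lambda>xs. tlift scale (\<lambda>ys. f xs ys) B) A = tlift scale (\<lambda>ys. tlift scale (\<lambda>xs. f xs ys) A) B"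
  unfolding tlift_def by (rule lin_ext_swap)

lemma linear_map_tlift_fun:
  assumes "A \<in> tensor_power scale n" "\<And>xs. length xs = n \<Longrightarrow> linear_map t scale (\<lambda>a. f a xs)"
  shows "linear_map t scale (\<lambda>a. tlift scale (f a) A)"
  unfolding tlift_def
  by (intro linear_map_lin_ext_fun assms(2) formal_tensorsD[OF trep_tensor_power[OF assms(1)]])

lemma multilinear_tlift_fun:
  assumes "A \<in> tensor_power scale n" "\<And>xs. length xs = n \<Longrightarrow> multilinear m (\<lambda>ys. f ys xs)"
  shows "multilinear m (\<lambda>ys. tlift scale (f ys) A)"
  unfolding tlift_def
  by (intro multilinear_lin_ext_fun assms(2) formal_tensorsD[OF trep_tensor_power[OF assms(1)]])

lemma linear_map_tlift: "linear_map scale scale L \<Longrightarrow> L (tlift scale f A) = tlift scale (\<lambda>xs. L (f xs)) A"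
  unfolding tlift_def by (rule linear_map_lin_ext)

lemma tlift_sum: "tlift scale (\<lambda>xs. \<Sum>a\<in>I. f a xs) A = (\<Sum>a\<in>I. tlift scale (f a) A)"
  unfolding tlift_def lin_ext_def scale_sum_right by (rule sum.swap)

end

lemma (in unital_algebra) tlift_tmult:
  assumes "multilinear 2 f" "A \<in> tensor_power s 2" "B \<in> tensor_power s 2"
  shows "tlift s f (tmult s A B) = tlift s (\<lambda>xs. tlift s (\<lambda>ys. f (map2 (*) xs ys)) B) A"
proof -
  have "lin_ext fscale (\<lambda>ys. Poly_Mapping.single (map2 (*) xs ys) 1) (trep B) \<in> formal_tensors 2"
    if "length xs = 2" for xs
    using that formal_tensorsD[OF trep_tensor_power[OF assms(3)]]
    by (intro formal_tensors_lin_ext formal_tensors_single) simp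
  then show ?thesis
    unfolding tmult_def using assms
    by (subst tlift_tclass_lin_ext) (auto simp: lin_ext_lin_ext lin_ext_single scale_one tlift_def)
qed

section \<open>Iterated comultiplications\<close>

context unital_module
begin

definition bilinear :: "('v \<Rightarrow> 'v \<Rightarrow> 'v) \<Rightarrow> bool" where
  "bilinear g \<longleftrightarrow> (\<forall>b. linear_map scale scale (\<lambda>a. g a b)) \<and> (\<forall>a. linear_map scale scale (g a))"

lemma bilinearI:
  "(\<And>b. linear_map scale scale (\<lambda>a. g a b)) \<Longrightarrow> (\<And>a. linear_map scale scale (\<lambda>b. g a b)) \<Longrightarrow> bilinear g"
  by (simp add: bilinear_def)

lemma bilinearD:
  "bilinear g \<Longrightarrow> linear_map scale scale (\<lambda>a. g a b)"
  "bilinear g \<Longrightarrow> linear_map scale scale (\<lambda>b. g a b)"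
  by (simp_all add: bilinear_def)

lemma bilinear_comp:
  "bilinear g \<Longrightarrow> linear_map scale scale f \<Longrightarrow> linear_map scale scale f' \<Longrightarrow> bilinear (\<lambda>a b. g (f a) (f' b))"
  by (auto simp: bilinear_def intro: linear_map_comp)

lemma multilinear_pair:
  assumes "bilinear g"
  shows "multilinear 2 (\<lambda>xs. g (xs ! 0) (xs ! 1))"
proof (rule multilinearI)
  fix xs :: "'v list" and i :: nat
  assume *: "length xs = 2" "i < 2"
  then consider "i = 0" | "i = 1" by linarith
  then show "linear_map scale scale (\<lambda>a. g (xs[i := a] ! 0) (xs[i := a] ! 1))"
    using * bilinearD[OF assms] by cases auto
qed

end

definition rectangular :: "nat \<Rightarrow> nat \<Rightarrow> 'a list list \<Rightarrow> bool" where
  "rectangular l n xss \<longleftrightarrow> length xss = l \<and> (\<forall>xs\<in>set xss. length xs = n)"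

lemma rectangular_Cons:
  "rectangular (Suc l) n (xs # xss) \<longleftrightarrow> length xs = n \<and> rectangular l n xss"
  by (auto simp: rectangular_def)

lemma length_concat_rectangular: "rectangular l n xss \<Longrightarrow> length (concat xss) = l * n"
  by (induction xss arbitrary: l) (auto simp: rectangular_def)

lemma card_Suc_image:
  "card (S \<inter> {..<Suc n}) = (if 0 \<in> S then 1 else 0) + card ({j. Suc j \<in> S} \<inter> {..<n})"
proof -
  have "S \<inter> {..<Suc n} = (if 0 \<in> S then {0} else {}) \<union> Suc ` ({j. Suc j \<in> S} \<inter> {..<n})"
    by (auto simp: less_Suc_eq_0_disj image_iff)
  moreover have "card (Suc ` ({j. Suc j \<in> S} \<inter> {..<n})) = card ({j. Suc j \<in> S} \<inter> {..<n})"
    by (rule card_image) simp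
  ultimately show ?thesis
    by (cases "0 \<in> S") auto
qed

lemma length_nths_card: "length (nths xs S) = card (S \<inter> {..<length xs})"
  unfolding length_nths by (rule arg_cong[of _ _ card]) auto

context counital_coalgebra
begin

text \<open>Sweedler notation: the sums of \<open>g h\<^sub>1 h\<^sub>2\<close> and of \<open>f [h\<^sub>1, \<dots>, h\<^sub>n]\<close>. They do not depend on the
  choice of representatives when \<open>g\<close> is bilinear and \<open>f\<close> multilinear.\<close>

definition sweedler2 :: "'h \<Rightarrow> ('h \<Rightarrow> 'h \<Rightarrow> 'h) \<Rightarrow> 'h" where
  "sweedler2 h g = tlift s (\<lambda>xs. g (xs ! 0) (xs ! 1)) (\<Delta> h)"

definition sweedler :: "nat \<Rightarrow> 'h \<Rightarrow> ('h list \<Rightarrow> 'h) \<Rightarrow> 'h" where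
  "sweedler n h f = tlift s f (iter_comult s \<Delta> \<epsilon> n h)"

lemma linear_map_sweedler2:
  assumes "bilinear g"
  shows "linear_map s s (\<lambda>h. sweedler2 h g)"
  by (rule linear_mapI)
    (simp_all only: sweedler2_def comult_add comult_scale
      tlift_tadd[OF multilinear_pair[OF assms] comult_closed comult_closed]
      tlift_tscale[OF multilinear_pair[OF assms] comult_closed])

lemma sweedler2_sum: "sweedler2 h (\<lambda>a b. \<Sum>i\<in>I. g i a b) = (\<Sum>i\<in>I. sweedler2 h (g i))"
  unfolding sweedler2_def by (rule tlift_sum)

text \<open>The axiom \<open>coassoc\<close> equates two elements of the third tensor power.
  Evaluating the trilinear \<open>T\<close> on each of them and unfolding \<open>tensor_two\<close>
  gives the two nested sums.\<close>

lemma sweedler2_coassoc: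
  assumes T: "\<And>b c. linear_map s s (\<lambda>a. T a b c)" "\<And>a c. linear_map s s (\<lambda>b. T a b c)"
    "\<And>a b. linear_map s s (\<lambda>c. T a b c)"
  shows "sweedler2 h (\<lambda>a c. sweedler2 a (\<lambda>u v. T u v c)) = sweedler2 h (\<lambda>a b. sweedler2 b (\<lambda>u v. T a u v))"
proof -
  let ?T = "\<lambda>xs. T (xs ! 0) (xs ! 1) (xs ! 2)"
  have ml: "multilinear 3 ?T"
  proof (rule multilinearI)
    fix xs :: "'h list" and i :: nat
    assume *: "length xs = 3" "i < 3"
    then consider "i = 0" | "i = 1" | "i = 2" by linarith
    then show "linear_map s s (\<lambda>a. ?T (xs[i := a]))"
      using * T by cases auto
  qed
  have "2 + 1 = (3::nat)" "1 + 2 = (3::nat)" by simp_all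
  then have ml21: "multilinear (2 + 1) ?T" and ml12: "multilinear (1 + 2) ?T"
    using ml by (simp_all only:)
  have pure: "tpure s [x] \<in> tensor_power s 1" for x
    by (rule tpure_tensor_power) simp
  have "tlift s ?T (tensor_two s 2 1 \<Delta> (\<lambda>x. tpure s [x]) (\<Delta> h)) =
      sweedler2 h (\<lambda>a c. tlift s (\<lambda>us. tlift s (\<lambda>vs. ?T (us @ vs)) (tpure s [c])) (\<Delta> a))"
    unfolding sweedler2_def by (rule tlift_tensor_two[OF ml21 comult_closed comult_closed pure])
  also have "\<dots> = sweedler2 h (\<lambda>a c. sweedler2 a (\<lambda>u v. T u v c))"
  proof -
    have "tlift s (\<lambda>us. tlift s (\<lambda>vs. ?T (us @ vs)) (tpure s [c])) (\<Delta> a) =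
        tlift s (\<lambda>us. T (us ! 0) (us ! 1) c) (\<Delta> a)" for a c
    proof (rule tlift_cong[OF comult_closed])
      fix us :: "'h list"
      assume us: "length us = 2"
      show "tlift s (\<lambda>vs. ?T (us @ vs)) (tpure s [c]) = T (us ! 0) (us ! 1) c"
        using multilinear_append_right[OF ml21 us] us by (subst tlift_tpure) (auto simp: nth_append)
    qed
    then show ?thesis by (simp add: sweedler2_def)
  qed
  finally have 1: "tlift s ?T (tensor_two s 2 1 \<Delta> (\<lambda>x. tpure s [x]) (\<Delta> h)) =
    sweedler2 h (\<lambda>a c. sweedler2 a (\<lambda>u v. T u v c))" .
  have "tlift s ?T (tensor_two s 1 2 (\<lambda>x. tpure s [x]) \<Delta> (\<Delta> h)) =
      sweedler2 h (\<lambda>a b. tlift s (\<lambda>us. tlift s (\<lambda>vs. ?T (us @ vs)) (\<Delta> b)) (tpure s [a]))"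
    unfolding sweedler2_def by (rule tlift_tensor_two[OF ml12 comult_closed pure comult_closed])
  also have "\<dots> = sweedler2 h (\<lambda>a b. sweedler2 b (\<lambda>u v. T a u v))"
  proof -
    have "tlift s (\<lambda>us. tlift s (\<lambda>vs. ?T (us @ vs)) (\<Delta> b)) (tpure s [a]) =
        tlift s (\<lambda>vs. T a (vs ! 0) (vs ! 1)) (\<Delta> b)" for a b
    proof -
      have "multilinear 1 (\<lambda>us. tlift s (\<lambda>vs. ?T (us @ vs)) (\<Delta> b))"
        by (rule multilinear_tlift_fun[OF comult_closed], rule multilinear_append_left[OF ml12])
      then show ?thesis
        by (subst tlift_tpure) (auto simp: numeral_2_eq_2)
    qed
    then show ?thesis by (simp add: sweedler2_def)
  qed
  finally show ?thesis
    using 1 by (simp only: coassoc)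
qed

lemma sweedler2_counit_left:
  assumes "linear_map s s L"
  shows "sweedler2 h (\<lambda>a b. s (\<epsilon> a) (L b)) = L h"
proof -
  have "L h = L (tlift s (\<lambda>xs. s (\<epsilon> (xs ! 0)) (xs ! 1)) (\<Delta> h))"
    by (simp only: counit_left)
  also have "\<dots> = sweedler2 h (\<lambda>a b. s (\<epsilon> a) (L b))"
    by (simp add: linear_map_tlift[OF assms] linear_map_scale[OF assms] sweedler2_def)
  finally show ?thesis ..
qed

lemma tensor_power_iter_comult: "iter_comult s \<Delta> \<epsilon> n h \<in> tensor_power s n"
proof (induction n arbitrary: h)
  case 0
  then show ?case by (auto intro!: tclass_tensor_power formal_tensors_single)
next
  case (Suc n)
  then show ?case
    using tensor_power_tensor_two[where m = 1 and n = n, OF comult_closed tpure_tensor_power]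
    by simp
qed

lemma sweedler_cong:
  "(\<And>xs. length xs = n \<Longrightarrow> f xs = g xs) \<Longrightarrow> sweedler n h f = sweedler n h g"
  unfolding sweedler_def by (rule tlift_cong[OF tensor_power_iter_comult])

lemma linear_map_sweedler_fun:
  "(\<And>xs. length xs = n \<Longrightarrow> linear_map t s (\<lambda>a. f a xs)) \<Longrightarrow> linear_map t s (\<lambda>a. sweedler n h (f a))"
  unfolding sweedler_def by (rule linear_map_tlift_fun[OF tensor_power_iter_comult])

lemma multilinear_sweedler_fun:
  "(\<And>xs. length xs = n \<Longrightarrow> multilinear m (\<lambda>ys. f ys xs)) \<Longrightarrow> multilinear m (\<lambda>ys. sweedler n h (f ys))"
  unfolding sweedler_def by (rule multilinear_tlift_fun[OF tensor_power_iter_comult])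

lemma linear_map_apply_sweedler:
  "linear_map s s L \<Longrightarrow> L (sweedler n h f) = sweedler n h (\<lambda>xs. L (f xs))"
  unfolding sweedler_def by (rule linear_map_tlift)

lemma sweedler_sum: "sweedler n h (\<lambda>xs. \<Sum>i\<in>I. f i xs) = (\<Sum>i\<in>I. sweedler n h (f i))"
  unfolding sweedler_def by (rule tlift_sum)

lemma sweedler_swap:
  "sweedler m h (\<lambda>xs. sweedler n k (\<lambda>ys. f xs ys)) = sweedler n k (\<lambda>ys. sweedler m h (\<lambda>xs. f xs ys))"
  unfolding sweedler_def by (rule tlift_swap)

lemma sweedler2_sweedler_swap:
  "sweedler2 h (\<lambda>a b. sweedler n k (\<lambda>ys. f a b ys)) = sweedler n k (\<lambda>ys. sweedler2 h (\<lambda>a b. f a b ys))"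
  unfolding sweedler_def sweedler2_def by (rule tlift_swap)

lemma sweedler_0: "sweedler 0 h f = s (\<epsilon> h) (f [])"
proof -
  have "multilinear 0 f" by (simp add: multilinear_def)
  then show ?thesis
    by (simp add: sweedler_def tlift_tclass formal_tensors_single lin_ext_single)
qed

lemma sweedler_Suc:
  assumes "multilinear (Suc n) f"
  shows "sweedler (Suc n) h f = sweedler2 h (\<lambda>a b. sweedler n b (\<lambda>ys. f (a # ys)))"
proof -
  have ml: "multilinear (1 + n) f" using assms by simp
  have pure: "tpure s [x] \<in> tensor_power s 1" for x
    by (rule tpure_tensor_power) simp
  have "tlift s (\<lambda>us. sweedler n b (\<lambda>vs. f (us @ vs))) (tpure s [a]) = sweedler n b (\<lambda>vs. f (a # vs))" for a b
  proof -
    have "multilinear 1 (\<lambda>us. sweedler n b (\<lambda>vs. f (us @ vs)))"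
      by (rule multilinear_sweedler_fun, rule multilinear_append_left[OF ml])
    then show ?thesis
      by (subst tlift_tpure) auto
  qed
  then show ?thesis
    using tlift_tensor_two[OF ml comult_closed[of h] pure tensor_power_iter_comult]
    by (simp add: sweedler_def sweedler2_def)
qed

lemma linear_map_sweedler:
  "multilinear n f \<Longrightarrow> linear_map s s (\<lambda>h. sweedler n h f)"
proof (induction n arbitrary: f)
  case 0
  then show ?case
    by (simp add: sweedler_0 linear_map_scale_coeff counit_linear)
next
  case (Suc n)
  have "bilinear (\<lambda>a b. sweedler n b (\<lambda>ys. f (a # ys)))"
    by (intro bilinearI linear_map_sweedler_fun multilinear_head[OF Suc.prems] Suc.IH multilinear_Cons[OF Suc.prems])
  then show ?case
    by (simp add: sweedler_Suc Suc linear_map_sweedler2)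
qed

lemma bilinear_sweedler_Cons:
  "multilinear (Suc n) f \<Longrightarrow> bilinear (\<lambda>a b. sweedler n b (\<lambda>ys. f (a # ys)))"
  by (intro bilinearI linear_map_sweedler_fun multilinear_head linear_map_sweedler multilinear_Cons)

text \<open>The recursion of \<open>iter_comult\<close> peels factors off the left one at a time;
  this generalised coassociativity allows h to be cut in two first. The left counit settles m = 0,
  and the induction step moves one factor across by coassociativity.\<close>

lemma sweedler_append:
  "multilinear (m + n) f \<Longrightarrow>
    sweedler (m + n) h f = sweedler2 h (\<lambda>a b. sweedler m a (\<lambda>xs. sweedler n b (\<lambda>ys. f (xs @ ys))))"
proof (induction m arbitrary: h f)
  case 0
  then have "linear_map s s (\<lambda>b. sweedler n b f)"
    by (simp add: linear_map_sweedler)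
  then show ?case
    by (simp add: sweedler_0 sweedler2_counit_left)
next
  case (Suc m)
  have ml: "multilinear (Suc (m + n)) f" and ml': "multilinear (Suc m + n) f"
    using Suc.prems by simp_all
  have inner: "multilinear (Suc m) (\<lambda>xs. sweedler n d (\<lambda>ys. f (xs @ ys)))" for d
    by (rule multilinear_sweedler_fun, rule multilinear_append_left[OF ml'])
  have outer: "linear_map s s (\<lambda>d. sweedler n d (\<lambda>ys. f (xs @ ys)))" if "length xs = Suc m" for xs
    by (intro linear_map_sweedler multilinear_append_right[OF ml' that])
  have "sweedler (Suc m + n) h f = sweedler2 h (\<lambda>a b. sweedler (m + n) b (\<lambda>zs. f (a # zs)))"
    by (simp add: sweedler_Suc ml)
  also have "\<dots> = sweedler2 h (\<lambda>a b. sweedler2 b (\<lambda>c d. sweedler m c (\<lambda>xs. sweedler n d (\<lambda>ys. f (a # xs @ ys)))))"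
    by (simp add: Suc.IH multilinear_Cons ml)
  also have "\<dots> = sweedler2 h (\<lambda>x d. sweedler2 x (\<lambda>a c. sweedler m c (\<lambda>xs. sweedler n d (\<lambda>ys. f (a # xs @ ys)))))"
  proof (rule sweedler2_coassoc[symmetric])
    show "linear_map s s (\<lambda>a. sweedler m b (\<lambda>xs. sweedler n c (\<lambda>ys. f (a # xs @ ys))))" for b c
      using bilinearD(1)[OF bilinear_sweedler_Cons[OF inner]] by simp
    show "linear_map s s (\<lambda>b. sweedler m b (\<lambda>xs. sweedler n c (\<lambda>ys. f (a # xs @ ys))))" for a c
      using bilinearD(2)[OF bilinear_sweedler_Cons[OF inner]] by simp
    show "linear_map s s (\<lambda>c. sweedler m b (\<lambda>xs. sweedler n c (\<lambda>ys. f (a # xs @ ys))))" for a b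
      using outer[of "a # _"] by (intro linear_map_sweedler_fun) simp
  qed
  also have "\<dots> = sweedler2 h (\<lambda>x d. sweedler (Suc m) x (\<lambda>xs. sweedler n d (\<lambda>ys. f (xs @ ys))))"
    by (simp add: sweedler_Suc inner)
  finally show ?case .
qed

section \<open>Comultiplying every entry of a list\<close>

primrec sweedler_list :: "nat \<Rightarrow> 'h list \<Rightarrow> ('h list list \<Rightarrow> 'h) \<Rightarrow> 'h" where
  "sweedler_list n [] f = f []"
| "sweedler_list n (h # hs) f = sweedler n h (\<lambda>x. sweedler_list n hs (\<lambda>xss. f (x # xss)))"

text \<open>The recursion mirrors that of \<open>sweedler_list\<close>, so that multilinearity is
  available exactly when a row is split off. Only rectangular arguments are tested, since
  \<open>multilinear\<close> constrains lists of one fixed length.\<close>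

primrec multilinear_rows :: "nat \<Rightarrow> nat \<Rightarrow> ('h list list \<Rightarrow> 'h) \<Rightarrow> bool" where
  "multilinear_rows n 0 f \<longleftrightarrow> True"
| "multilinear_rows n (Suc l) f \<longleftrightarrow>
     (\<forall>xss. rectangular l n xss \<longrightarrow> multilinear n (\<lambda>xs. f (xs # xss))) \<and>
     (\<forall>xs. length xs = n \<longrightarrow> multilinear_rows n l (\<lambda>xss. f (xs # xss)))"

lemma multilinear_rows_cong:
  "multilinear_rows n l f \<Longrightarrow> (\<And>xss. rectangular l n xss \<Longrightarrow> g xss = f xss) \<Longrightarrow> multilinear_rows n l g"
proof (induction l arbitrary: f g)
  case (Suc l)
  have "multilinear n (\<lambda>xs. g (xs # xss))" if "rectangular l n xss" for xss
    by (rule multilinear_cong[of n "\<lambda>xs. f (xs # xss)"]) (use Suc that in \<open>auto simp: rectangular_Cons\<close>)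
  moreover have "multilinear_rows n l (\<lambda>xss. g (xs # xss))" if "length xs = n" for xs
    by (rule Suc.IH[of "\<lambda>xss. f (xs # xss)"]) (use Suc that in \<open>auto simp: rectangular_Cons\<close>)
  ultimately show ?case by simp
qed simp

lemma multilinear_rows_concat:
  "multilinear (l * n) f \<Longrightarrow> multilinear_rows n l (\<lambda>xss. f (concat xss))"
proof (induction l arbitrary: f)
  case (Suc l)
  then have f: "multilinear (n + l * n) f" by simp
  show ?case
    using multilinear_append_left[OF f length_concat_rectangular] Suc.IH[OF multilinear_append_right[OF f]] by simp
qed simp

lemma sweedler_list_cong:
  "(\<And>xss. rectangular (length hs) n xss \<Longrightarrow> f xss = g xss) \<Longrightarrow> sweedler_list n hs f = sweedler_list n hs g"
proof (induction hs arbitrary: f g)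
  case Nil
  then show ?case by (simp add: rectangular_def)
next
  case (Cons h hs)
  show ?case
    unfolding sweedler_list.simps
    by (intro sweedler_cong Cons.IH Cons.prems) (simp add: rectangular_Cons)
qed

lemma multilinear_sweedler_list_fun:
  "(\<And>xss. rectangular (length hs) n xss \<Longrightarrow> multilinear m (\<lambda>ys. f ys xss)) \<Longrightarrow>
    multilinear m (\<lambda>ys. sweedler_list n hs (f ys))"
proof (induction hs arbitrary: f)
  case Nil
  then show ?case by (simp add: rectangular_def)
next
  case (Cons h hs)
  show ?case
    unfolding sweedler_list.simps
    by (intro multilinear_sweedler_fun Cons.IH Cons.prems) (simp add: rectangular_Cons)
qed

lemma sweedler_list_sum:
  "sweedler_list n hs (\<lambda>xss. \<Sum>i\<in>I. f i xss) = (\<Sum>i\<in>I. sweedler_list n hs (f i))"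
proof (induction hs arbitrary: f)
  case (Cons h hs)
  show ?case by (simp add: Cons sweedler_sum)
qed simp

lemma multilinear_sweedler_list:
  "multilinear_rows n l f \<Longrightarrow> multilinear l (\<lambda>hs. sweedler_list n hs f)"
proof (induction l arbitrary: f)
  case (Suc l)
  show ?case
  proof (rule multilinear_ConsI)
    fix hs :: "'h list"
    assume "length hs = l"
    then have "multilinear n (\<lambda>x. sweedler_list n hs (\<lambda>xss. f (x # xss)))"
      using Suc.prems by (intro multilinear_sweedler_list_fun) simp
    then show "linear_map s s (\<lambda>a. sweedler_list n (a # hs) f)"
      by (simp add: linear_map_sweedler)
  next
    show "multilinear l (\<lambda>hs. sweedler_list n (a # hs) f)" for a
      using Suc by (auto intro!: multilinear_sweedler_fun)
  qed
qed (simp add: multilinear_def)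

text \<open>Induction through \<open>sweedler_append\<close>, which takes the first n factors from
  one part of h and leaves the other l blocks to the other part.\<close>

lemma sweedler_concat:
  "multilinear (l * n) f \<Longrightarrow>
    sweedler (l * n) h f = sweedler l h (\<lambda>ys. sweedler_list n ys (\<lambda>xss. f (concat xss)))"
proof (induction l arbitrary: h f)
  case 0
  show ?case by (simp add: sweedler_0)
next
  case (Suc l)
  then have f: "multilinear (n + l * n) f" by simp
  have "sweedler (Suc l * n) h f =
      sweedler2 h (\<lambda>a b. sweedler n a (\<lambda>xs. sweedler (l * n) b (\<lambda>zs. f (xs @ zs))))"
    using sweedler_append[OF f] by simp
  also have "\<dots> = sweedler2 h (\<lambda>a b. sweedler n a (\<lambda>xs. sweedler l b (\<lambda>ys. sweedler_list n ys (\<lambda>xss. f (xs @ concat xss)))))"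
    by (simp add: Suc.IH multilinear_append_right[OF f] cong: sweedler_cong)
  \<comment> \<open>The sums over the parts of \<open>a\<close> and of \<open>b\<close> are
    independent; once exchanged, \<open>a\<close> becomes the head of the list whose entries are
    comultiplied.\<close>
  also have "\<dots> = sweedler2 h (\<lambda>a b. sweedler l b (\<lambda>ys. sweedler_list n (a # ys) (\<lambda>xss. f (concat xss))))"
    by (simp add: sweedler_swap[of n])
  also have "\<dots> = sweedler (Suc l) h (\<lambda>ys. sweedler_list n ys (\<lambda>xss. f (concat xss)))"
    by (rule sweedler_Suc[symmetric], rule multilinear_sweedler_list, rule multilinear_rows_concat, fact)
  finally show ?case .
qed

text \<open>The auxiliary recursion passes an environment \<open>\<phi>\<close> instead of a list, so that the order of
  summation becomes a fold of pairwise commuting operators.\<close>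

lemma sweedler_list_env:
  "distinct js \<Longrightarrow> sweedler_list n (map u js) f =
    foldr (\<lambda>j G \<phi>. sweedler n (u j) (\<lambda>x. G (\<phi>(j := x)))) js (\<lambda>\<phi>. f (map \<phi> js)) \<phi>"
proof -
  define op where "op = (\<lambda>j G \<phi>. sweedler n (u j) (\<lambda>x. G (\<phi>(j := x))))"
  \<comment> \<open>The induction needs an already processed prefix \<open>is\<close>. Distinctness
    ensures that later updates of the environment do not overwrite its values.\<close>
  have "foldr op js (\<lambda>\<phi>. f (map \<phi> (is @ js))) \<phi> = sweedler_list n (map u js) (\<lambda>xss. f (map \<phi> is @ xss))"
    if "distinct (is @ js)" for "is"
    using that
  proof (induction js arbitrary: "is" \<phi>)
    case (Cons j js)
    have "foldr op (j # js) (\<lambda>\<phi>. f (map \<phi> (is @ j # js))) \<phi> =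
        sweedler n (u j) (\<lambda>x. foldr op js (\<lambda>\<phi>. f (map \<phi> ((is @ [j]) @ js))) (\<phi>(j := x)))"
      by (simp add: op_def)
    also have "\<dots> = sweedler n (u j) (\<lambda>x. sweedler_list n (map u js) (\<lambda>xss. f (map (\<phi>(j := x)) (is @ [j]) @ xss)))"
      by (subst Cons.IH) (use Cons.prems in auto)
    also have "\<dots> = sweedler_list n (map u (j # js)) (\<lambda>xss. f (map \<phi> is @ xss))"
      using Cons.prems by (simp add: map_fun_upd)
    finally show ?case .
  qed simp
  from this[of "[]"] show "distinct js \<Longrightarrow> ?thesis" by (simp add: op_def)
qed

text \<open>Entries of the list are comultiplied independently of each other. Both sides therefore
  perform the same updates of an environment in different orders: updates at different indices
  commute, and \<open>map \<pi> [0..<l]\<close> is a rearrangement of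
  \<open>[0..<l]\<close>.\<close>

lemma sweedler_list_permute:
  assumes \<pi>: "\<pi> permutes {..<l}" and hs: "length hs = l"
  shows "sweedler_list n (map (\<lambda>j. hs ! \<pi> j) [0..<l]) f =
    sweedler_list n hs (\<lambda>xss. f (map (\<lambda>j. xss ! \<pi> j) [0..<l]))"
proof -
  define op where "op = (\<lambda>j G \<phi>. sweedler n (hs ! j) (\<lambda>x. G (\<phi>(j := x))))"
  have comm: "op i \<circ> op j = op j \<circ> op i" for i j
  proof (cases "i = j")
    case False
    then show ?thesis
      by (auto simp: op_def fun_eq_iff fun_upd_twist sweedler_swap[of n "hs ! i"])
  qed simp
  have dist: "distinct (map \<pi> [0..<l])"
    using permutes_inj_on[OF \<pi>] by (simp add: distinct_map)
  have "mset (map \<pi> [0..<l]) = mset [0..<l]"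
    using dist permutes_image[OF \<pi>] by (intro set_eq_iff_mset_eq_distinct[THEN iffD1]) (auto simp: atLeast0LessThan)
  then have fold: "foldr op (map \<pi> [0..<l]) = foldr op [0..<l]"
    unfolding foldr_conv_fold by (intro fold_multiset_equiv comm) simp
  \<comment> \<open>The initial environment is a dummy: every index that is read has been updated
    before.\<close>
  have "sweedler_list n (map ((!) hs) (map \<pi> [0..<l])) f =
      foldr op (map \<pi> [0..<l]) (\<lambda>\<phi>. f (map \<phi> (map \<pi> [0..<l]))) (\<lambda>_. [])"
    unfolding op_def by (rule sweedler_list_env[OF dist])
  also have "(\<lambda>\<phi>. f (map \<phi> (map \<pi> [0..<l]))) = (\<lambda>\<phi>. f (map (\<lambda>j. map \<phi> [0..<l] ! \<pi> j) [0..<l]))"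
    using permutes_in_image[OF \<pi>] by (intro ext arg_cong[of _ _ f]) auto
  also have "foldr op (map \<pi> [0..<l]) \<dots> (\<lambda>_. []) =
      sweedler_list n (map ((!) hs) [0..<l]) (\<lambda>xss. f (map (\<lambda>j. xss ! \<pi> j) [0..<l]))"
    unfolding fold unfolding op_def
    by (rule sweedler_list_env[where f = "\<lambda>xss. f (map (\<lambda>j. xss ! \<pi> j) [0..<l])", symmetric]) simp
  also have "map ((!) hs) [0..<l] = hs"
    using hs map_nth by metis
  finally show ?thesis by (simp add: comp_def)
qed

section \<open>Contracting tensor factors with the counit\<close>

lemma prod_counit_Cons:
  "(\<Prod>m\<in>{..<length (x # xs)} - S. \<epsilon> ((x # xs) ! m)) =
    (if 0 \<in> S then 1 else \<epsilon> x) * (\<Prod>m\<in>{..<length xs} - {j. Suc j \<in> S}. \<epsilon> (xs ! m))"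
proof -
  let ?A = "if 0 \<in> S then {} else {0}"
  let ?B = "{..<length xs} - {j. Suc j \<in> S}"
  have "{..<length (x # xs)} - S = ?A \<union> Suc ` ?B"
    by (auto simp: less_Suc_eq_0_disj)
  then have "(\<Prod>m\<in>{..<length (x # xs)} - S. \<epsilon> ((x # xs) ! m)) =
      (\<Prod>m\<in>?A. \<epsilon> ((x # xs) ! m)) * (\<Prod>m\<in>Suc ` ?B. \<epsilon> ((x # xs) ! m))"
    by (simp only:) (rule prod.union_disjoint; auto)
  also have "(\<Prod>m\<in>Suc ` ?B. \<epsilon> ((x # xs) ! m)) = (\<Prod>m\<in>?B. \<epsilon> (xs ! m))"
    by (subst prod.reindex) auto
  finally show ?thesis by auto
qed

text \<open>Every slot is read exactly once: through \<epsilon> if its index lies outside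
  \<open>S\<close>, as an argument of \<open>g\<close> otherwise. The product is bounded by
  \<open>length xs\<close> and not by \<open>n\<close>, so that \<open>prod_counit_Cons\<close>
  rewrites unconditionally.\<close>

lemma multilinear_counit:
  "multilinear (card (S \<inter> {..<n})) g \<Longrightarrow>
    multilinear n (\<lambda>xs. s (\<Prod>m\<in>{..<length xs} - S. \<epsilon> (xs ! m)) (g (nths xs S)))"
proof (induction n arbitrary: S g)
  case 0
  show ?case by (simp add: multilinear_def)
next
  case (Suc n)
  let ?S = "{j. Suc j \<in> S}"
  show ?case
  proof (cases "0 \<in> S")
    case True
    with Suc.prems have g: "multilinear (Suc (card (?S \<inter> {..<n}))) g"
      by (simp add: card_Suc_image)
    show ?thesis
      unfolding prod_counit_Cons nths_Cons
    proof (rule multilinear_ConsI, goal_cases)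
      case (1 xs)
      then show ?case
        unfolding prod_counit_Cons nths_Cons using True
        by (auto intro!: linear_map_scale_image multilinear_head[OF g] simp: length_nths_card)
    next
      case (2 a)
      then show ?case
        unfolding prod_counit_Cons nths_Cons using True Suc.IH[OF multilinear_Cons[OF g, of a]]
        by simp
    qed
  next
    case False
    with Suc.prems have g: "multilinear (card (?S \<inter> {..<n})) g"
      by (simp add: card_Suc_image)
    show ?thesis
    proof (rule multilinear_ConsI, goal_cases)
      case (1 xs)
      then show ?case
        unfolding prod_counit_Cons nths_Cons using False
        by (auto intro!: linear_map_scale_coeff counit_linear simp flip: scale_scale)
    next
      case (2 a)
      then show ?case
        unfolding prod_counit_Cons nths_Cons using False Suc.IH[OF g]
        by (auto intro!: linear_map_scale_image simp: multilinear_def simp flip: scale_scale)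
    qed
  qed
qed

text \<open>A counit applied to one factor of the comultiplication removes that factor. The head
  becomes an argument of \<open>g\<close> if 0 is in \<open>S\<close> and is absorbed by the left
  counit axiom otherwise; \<open>{j. Suc j \<in> S}\<close> is \<open>S\<close> as seen from the
  tail.\<close>

lemma sweedler_counit:
  "multilinear (card (S \<inter> {..<n})) g \<Longrightarrow>
    sweedler n h (\<lambda>xs. s (\<Prod>m\<in>{..<length xs} - S. \<epsilon> (xs ! m)) (g (nths xs S))) =
    sweedler (card (S \<inter> {..<n})) h g"
proof (induction n arbitrary: S g h)
  case 0
  show ?case by (simp add: sweedler_0 scale_one)
next
  case (Suc n)
  let ?S = "{j. Suc j \<in> S}"
  note * = sweedler_Suc[OF multilinear_counit[OF Suc.prems], unfolded prod_counit_Cons nths_Cons]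
  show ?case
  proof (cases "0 \<in> S")
    case True
    with Suc.prems have g: "multilinear (Suc (card (?S \<inter> {..<n}))) g"
      by (simp add: card_Suc_image)
    then show ?thesis
      using True Suc.IH[OF multilinear_Cons[OF g]]
      by (simp add: * sweedler_Suc card_Suc_image)
  next
    case False
    with Suc.prems have g: "multilinear (card (?S \<inter> {..<n})) g"
      by (simp add: card_Suc_image)
    have "sweedler n b (\<lambda>xs. s (\<epsilon> a * (\<Prod>m\<in>{..<length xs} - ?S. \<epsilon> (xs ! m))) (g (nths xs ?S))) =
        s (\<epsilon> a) (sweedler (card (?S \<inter> {..<n})) b g)" for a b
      by (simp add: Suc.IH[OF g, symmetric] linear_map_apply_sweedler[OF linear_map_scale_const] scale_scale)
    then show ?thesis
      using False by (simp add: * card_Suc_image sweedler2_counit_left linear_map_sweedler[OF g])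
  qed
qed

end

section \<open>Bialgebras and gradings\<close>

context bialgebra
begin

lemma sweedler2_mult:
  assumes g: "bilinear g"
  shows "sweedler2 (x * y) g = sweedler2 x (\<lambda>a b. sweedler2 y (\<lambda>c d. g (a * c) (b * d)))"
proof -
  have "sweedler2 (x * y) g =
      tlift s (\<lambda>xs. tlift s (\<lambda>ys. g (map2 (*) xs ys ! 0) (map2 (*) xs ys ! 1)) (\<Delta> y)) (\<Delta> x)"
    unfolding sweedler2_def comult_mult
    by (rule tlift_tmult[OF multilinear_pair[OF g] comult_closed comult_closed])
  also have "\<dots> = sweedler2 x (\<lambda>a b. sweedler2 y (\<lambda>c d. g (a * c) (b * d)))"
    unfolding sweedler2_def by (intro tlift_cong[OF comult_closed]) simp
  finally show ?thesis .
qed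

lemma sweedler2_one:
  assumes "bilinear g"
  shows "sweedler2 1 g = g 1 1"
proof -
  have "multilinear (length [1, 1]) (\<lambda>xs. g (xs ! 0) (xs ! 1))"
    using multilinear_pair[OF assms] by (simp add: numeral_2_eq_2)
  then show ?thesis
    unfolding sweedler2_def comult_one by (subst tlift_tpure) auto
qed

lemma sweedler_one: "multilinear n f \<Longrightarrow> sweedler n 1 f = f (replicate n 1)"
proof (induction n arbitrary: f)
  case 0
  show ?case by (simp add: sweedler_0 counit_one scale_one)
next
  case (Suc n)
  then show ?case
    by (simp add: sweedler_Suc sweedler2_one bilinear_sweedler_Cons multilinear_Cons)
qed

lemma multilinear_times_right:
  "multilinear n f \<Longrightarrow> length xs = n \<Longrightarrow> multilinear n (\<lambda>ys. f (map2 (*) xs ys))"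
  by (rule multilinear_map2) (auto intro: linear_map_mult_right linear_map_id)

text \<open>Multiplicativity of the binary comultiplication handles the first split and produces the
  product \<open>b * d\<close>, to which the induction hypothesis applies. Moving the split of
  \<open>y\<close> inside the sum over the parts of \<open>b\<close> then reassembles the iterated
  comultiplication of \<open>y\<close>.\<close>

lemma sweedler_mult:
  "multilinear n f \<Longrightarrow> sweedler n (x * y) f = sweedler n x (\<lambda>xs. sweedler n y (\<lambda>ys. f (map2 (*) xs ys)))"
proof (induction n arbitrary: f x y)
  case 0
  show ?case by (simp add: sweedler_0 counit_mult scale_scale)
next
  case (Suc n)
  note f = Suc.prems
  have "multilinear (Suc n) (\<lambda>xs. f (map2 (*) xs ys))" if "length ys = Suc n" for ys
  proof -
    \<comment> \<open>In \<open>multilinear_map2\<close> it is the second list that varies, so the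
      two arguments are flipped first.\<close>
    have "map2 (*) xs ys = map2 (\<lambda>y x. x * y) ys xs" for xs :: "'h list"
      by (subst zip_commute) (simp add: case_prod_beta)
    then show ?thesis
      using multilinear_map2[OF f that, of "\<lambda>y x. x * y"] linear_map_mult_left[OF linear_map_id] by simp
  qed
  then have outer: "multilinear (Suc n) (\<lambda>xs. sweedler (Suc n) y (\<lambda>ys. f (map2 (*) xs ys)))"
    by (rule multilinear_sweedler_fun)
  have "sweedler (Suc n) (x * y) f = sweedler2 (x * y) (\<lambda>a b. sweedler n b (\<lambda>ys. f (a # ys)))"
    by (rule sweedler_Suc[OF f])
  also have "\<dots> = sweedler2 x (\<lambda>a b. sweedler2 y (\<lambda>c d. sweedler n (b * d) (\<lambda>ys. f (a * c # ys))))"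
    by (rule sweedler2_mult[OF bilinear_sweedler_Cons[OF f]])
  also have "\<dots> = sweedler2 x (\<lambda>a b. sweedler n b (\<lambda>xs.
      sweedler2 y (\<lambda>c d. sweedler n d (\<lambda>ys. f (a * c # map2 (*) xs ys)))))"
    by (simp add: Suc.IH[OF multilinear_Cons[OF f]] sweedler2_sweedler_swap)
  also have "\<dots> = sweedler2 x (\<lambda>a b. sweedler n b (\<lambda>xs. sweedler (Suc n) y (\<lambda>ys. f (map2 (*) (a # xs) ys))))"
    by (simp add: sweedler_Suc multilinear_times_right[OF f] cong: sweedler_cong)
  also have "\<dots> = sweedler (Suc n) x (\<lambda>xs. sweedler (Suc n) y (\<lambda>ys. f (map2 (*) xs ys)))"
    by (rule sweedler_Suc[OF outer, symmetric])
  finally show ?case .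
qed

text \<open>The product of the pure tensors \<open>xss\<close> in the n-th tensor power of the
  algebra. The start value is the unit there, matching the iterated comultiplication of 1.\<close>

definition column_products :: "nat \<Rightarrow> 'h list list \<Rightarrow> 'h list" where
  "column_products n xss = foldr (map2 (*)) xss (replicate n 1)"

lemma length_column_products:
  "\<forall>xs\<in>set xss. length xs = n \<Longrightarrow> length (column_products n xss) = n"
  by (induction xss) (simp_all add: column_products_def)

lemma nth_column_products:
  "\<forall>xs\<in>set xss. length xs = n \<Longrightarrow> i < n \<Longrightarrow> column_products n xss ! i = prod_list (map (\<lambda>xs. xs ! i) xss)"
proof (induction xss)
  case (Cons xs xss)
  then show ?case
    using length_column_products[of xss n] by (simp add: column_products_def)
qed (simp add: column_products_def)

lemma sweedler_prod_list:
  "multilinear n f \<Longrightarrow> sweedler n (prod_list hs) f = sweedler_list n hs (\<lambda>xss. f (column_products n xss))"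
proof (induction hs arbitrary: f)
  case Nil
  then show ?case by (simp add: sweedler_one column_products_def)
next
  case (Cons h hs)
  then have "sweedler n (h * prod_list hs) f = sweedler_list n (h # hs) (\<lambda>xss. f (column_products n xss))"
    by (simp add: sweedler_mult multilinear_times_right column_products_def cong: sweedler_cong)
  then show ?case by simp
qed

lemma multilinear_prod_list: "multilinear n prod_list"
proof (induction n)
  case (Suc n)
  show ?case
    by (rule multilinear_ConsI)
      (use Suc in \<open>auto simp: multilinear_def intro: linear_map_mult_left linear_map_mult_right linear_map_id\<close>)
qed (simp add: multilinear_def)

lemma convolution_sweedler2:
  assumes "linear_map s s f" "linear_map s s g"
  shows "convolution s \<Delta> f g h = sweedler2 h (\<lambda>a b. f a * g b)"
proof -
  have "bilinear (*)"
    by (intro bilinearI linear_map_mult_left linear_map_mult_right linear_map_id)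
  then have ml: "multilinear (length [f, g]) (\<lambda>xs. xs ! 0 * xs ! 1)"
    using multilinear_pair by (simp add: numeral_2_eq_2)
  have "convolution s \<Delta> f g h = tlift s (\<lambda>xs. map2 (\<lambda>f x. f x) [f, g] xs ! 0 * map2 (\<lambda>f x. f x) [f, g] xs ! 1) (\<Delta> h)"
    unfolding convolution_def comp_def
    using comult_closed[of h] by (subst tlift_tensor_maps[OF ml]) (simp_all add: numeral_2_eq_2)
  also have "\<dots> = sweedler2 h (\<lambda>a b. f a * g b)"
    unfolding sweedler2_def by (rule tlift_cong[OF comult_closed]) simp
  finally show ?thesis .
qed

end

section \<open>Projections to homogeneous components\<close>

context graded_module
begin

lemma decomposesI:
  assumes "\<And>n. f n \<in> \<G> n" "finite A" "\<And>n. n \<notin> A \<Longrightarrow> f n = 0" "x = sum f A"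
  shows "decomposes \<G> x f"
proof -
  have sub: "{n. f n \<noteq> 0} \<subseteq> A" using assms(3) by auto
  then have "sum f {n. f n \<noteq> 0} = sum f A"
    by (intro sum.mono_neutral_left assms(2)) auto
  then show ?thesis
    using assms finite_subset[OF sub] by (simp add: decomposes_def)
qed

lemma decomposes_hproj: "decomposes \<G> x (\<lambda>n. hproj \<G> n x)"
  unfolding hproj_def using theI'[OF direct_sum] by simp

lemma hproj_eqI: "decomposes \<G> x f \<Longrightarrow> hproj \<G> n x = f n"
  unfolding hproj_def using the1_equality[OF direct_sum] by simp

lemma hproj_component: "hproj \<G> n x \<in> \<G> n"
  and finite_hproj: "finite {n. hproj \<G> n x \<noteq> 0}"
  and sum_hproj: "(\<Sum>n | hproj \<G> n x \<noteq> 0. hproj \<G> n x) = x"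
  using decomposes_hproj[of x] by (simp_all add: decomposes_def)

lemma hproj_add: "hproj \<G> n (x + y) = hproj \<G> n x + hproj \<G> n y"
proof (rule hproj_eqI, rule decomposesI)
  let ?A = "{n. hproj \<G> n x \<noteq> 0} \<union> {n. hproj \<G> n y \<noteq> 0}"
  show fin: "finite ?A" using finite_hproj by simp
  have "sum (\<lambda>n. hproj \<G> n z) ?A = z" if "z \<in> {x, y}" for z
    using that fin by (subst (2) sum_hproj[of z, symmetric], intro sum.mono_neutral_right) auto
  then show "x + y = (\<Sum>n\<in>?A. hproj \<G> n x + hproj \<G> n y)"
    by (simp add: sum.distrib)
qed (auto intro: component_add hproj_component)

lemma hproj_scale: "hproj \<G> n (s c x) = s c (hproj \<G> n x)"
proof (rule hproj_eqI, rule decomposesI)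
  show "s c x = (\<Sum>n | hproj \<G> n x \<noteq> 0. s c (hproj \<G> n x))"
    by (simp add: sum_hproj flip: scale_sum_right)
qed (auto intro: component_scale hproj_component finite_hproj)

lemma linear_map_hproj: "linear_map s s (hproj \<G> n)"
  by (intro linear_mapI hproj_add hproj_scale)

lemma hproj_homogeneous: "x \<in> \<G> m \<Longrightarrow> hproj \<G> n x = (if n = m then x else 0)"
  by (rule hproj_eqI, rule decomposesI[of _ "{m}"]) (auto intro: component_zero)

lemma hproj_hproj: "hproj \<G> m (hproj \<G> n x) = (if m = n then hproj \<G> n x else 0)"
  by (rule hproj_homogeneous) (rule hproj_component)

text \<open>Every element is the finite sum of its components. In this way the grading axioms, which
  speak of homogeneous elements, are carried over to identities on the whole module.\<close>

lemma linear_map_eqI: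
  assumes "linear_map s t L" "linear_map s t L'" "\<And>n x. x \<in> \<G> n \<Longrightarrow> L x = L' x"
  shows "L x = L' x"
proof -
  have "L (\<Sum>n | hproj \<G> n x \<noteq> 0. hproj \<G> n x) = L' (\<Sum>n | hproj \<G> n x \<noteq> 0. hproj \<G> n x)"
    by (simp add: linear_map_sum[OF assms(1)] linear_map_sum[OF assms(2)] assms(3)[OF hproj_component])
  then show ?thesis by (simp only: sum_hproj)
qed

lemma map2_hproj_idem: "map2 (hproj \<G>) ns (map2 (hproj \<G>) ns xs) = map2 (hproj \<G>) ns xs"
proof (induction ns arbitrary: xs)
  case (Cons n ns)
  then show ?case by (cases xs) (simp_all add: hproj_hproj)
qed simp

end

section \<open>Degrees in products and coproducts\<close>

definition weak_compositions :: "nat \<Rightarrow> nat \<Rightarrow> nat list set" where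
  "weak_compositions l n = {ns. length ns = l \<and> sum_list ns = n}"

lemma finite_weak_compositions: "finite (weak_compositions l n)"
proof (rule finite_subset)
  show "weak_compositions l n \<subseteq> {ns. set ns \<subseteq> {..n} \<and> length ns = l}"
    by (auto simp: weak_compositions_def member_le_sum_list)
qed (simp add: finite_lists_length_eq)

lemma sum_weak_compositions_Suc:
  "(\<Sum>ns\<in>weak_compositions (Suc l) n. f ns) = (\<Sum>i\<le>n. \<Sum>ns\<in>weak_compositions l (n - i). f (i # ns))"
proof -
  have "(\<Sum>i\<le>n. \<Sum>ns\<in>weak_compositions l (n - i). f (i # ns)) =
      (\<Sum>(i, ns)\<in>(SIGMA i:{..n}. weak_compositions l (n - i)). f (i # ns))"
    by (rule sum.Sigma) (auto simp: finite_weak_compositions)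
  also have "\<dots> = (\<Sum>ns\<in>weak_compositions (Suc l) n. f ns)"
    by (rule sum.reindex_bij_witness[where i = "\<lambda>ns. (hd ns, tl ns)" and j = "\<lambda>(i, ns). i # ns"])
      (auto simp: weak_compositions_def length_Suc_conv)
  finally show ?thesis ..
qed

context connected_graded_bialgebra
begin

lemma hproj_one: "hproj \<G> n 1 = (if n = 0 then 1 else 0)"
  using hproj_homogeneous[OF graded_one] by simp

lemma hproj_mult: "hproj \<G> n (x * y) = (\<Sum>i\<le>n. hproj \<G> i x * hproj \<G> (n - i) y)"
proof (rule linear_map_eqI[of s "\<lambda>x. hproj \<G> n (x * y)"])
  fix a x assume x: "x \<in> \<G> a"
  show "hproj \<G> n (x * y) = (\<Sum>i\<le>n. hproj \<G> i x * hproj \<G> (n - i) y)"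
  proof (rule linear_map_eqI[of s "\<lambda>y. hproj \<G> n (x * y)"])
    fix b y assume y: "y \<in> \<G> b"
    \<comment> \<open>Only i = a can contribute. If a exceeds n, no index does and n = a + b fails
      as well, so the truncated n - a does no harm.\<close>
    have "(\<Sum>i\<le>n. hproj \<G> i x * hproj \<G> (n - i) y) = (\<Sum>i\<le>n. if i = a then x * hproj \<G> (n - a) y else 0)"
      by (intro sum.cong) (auto simp: hproj_homogeneous[OF x])
    also have "\<dots> = (if n = a + b then x * y else 0)"
      by (auto simp: hproj_homogeneous[OF y])
    finally show "hproj \<G> n (x * y) = (\<Sum>i\<le>n. hproj \<G> i x * hproj \<G> (n - i) y)"
      by (simp add: hproj_homogeneous[OF graded_mult[OF x y]])
  qed (intro linear_map_comp[OF linear_map_hproj] linear_map_sum_image linear_map_mult_right linear_map_hproj linear_map_id)+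
qed (intro linear_map_comp[OF linear_map_hproj] linear_map_sum_image linear_map_mult_left linear_map_hproj linear_map_id)+

lemma hproj_prod_list:
  "hproj \<G> n (prod_list xs) = (\<Sum>ns\<in>weak_compositions (length xs) n. prod_list (map2 (hproj \<G>) ns xs))"
proof (induction xs arbitrary: n)
  case Nil
  have "weak_compositions 0 n = (if n = 0 then {[]} else {})"
    by (auto simp: weak_compositions_def)
  then show ?case by (simp add: hproj_one)
next
  case (Cons x xs)
  then show ?case
    by (simp add: hproj_mult sum_weak_compositions_Suc sum_distrib_left)
qed

lemma counit_hproj: "\<epsilon> (hproj \<G> n x) = (if n = 0 then \<epsilon> x else 0)"
proof (rule linear_map_eqI[of "(*)" "\<lambda>x. \<epsilon> (hproj \<G> n x)"])
  show "linear_map s (*) (\<lambda>x. \<epsilon> (hproj \<G> n x))"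
    by (rule linear_map_comp[OF counit_linear linear_map_hproj])
  show "linear_map s (*) (\<lambda>x. if n = 0 then \<epsilon> x else 0)"
    using counit_linear by (auto simp: linear_map_def)
  fix m x assume x: "x \<in> \<G> m"
  show "\<epsilon> (hproj \<G> n x) = (if n = 0 then \<epsilon> x else 0)"
    using graded_counit[OF x] by (auto simp: hproj_homogeneous[OF x] linear_map_zero[OF counit_linear])
qed

lemma hproj_0: "hproj \<G> 0 x = s (\<epsilon> x) 1"
proof (rule linear_map_eqI[OF linear_map_hproj])
  show "linear_map s s (\<lambda>x. s (\<epsilon> x) 1)"
    by (rule linear_map_scale_coeff[OF counit_linear])
  fix m x assume x: "x \<in> \<G> m"
  show "hproj \<G> 0 x = s (\<epsilon> x) 1"
  proof (cases "m = 0")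
    case True
    then obtain c where "x = s c 1" using x connected by auto
    then show ?thesis
      using True hproj_homogeneous[OF x, of 0] by (simp add: linear_map_scale[OF counit_linear] counit_one)
  next
    case False
    then show ?thesis using graded_counit[OF x] by (simp add: hproj_homogeneous[OF x])
  qed
qed

text \<open>The axiom \<open>graded_comult\<close> yields some homogeneous representative of
  \<open>\<Delta> h\<close>, possibly not the one picked by \<open>trep\<close>. As \<open>g\<close>
  and \<open>g'\<close> are bilinear, both can be evaluated on it.\<close>

lemma sweedler2_homogeneous:
  assumes "h \<in> \<G> m" "bilinear g" "bilinear g'"
    "\<And>i j a b. i + j = m \<Longrightarrow> a \<in> \<G> i \<Longrightarrow> b \<in> \<G> j \<Longrightarrow> g a b = g' a b"
  shows "sweedler2 h g = sweedler2 h g'"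
proof -
  obtain z where z: "\<Delta> h = tclass s 2 z"
      "Poly_Mapping.keys z \<subseteq> {[a, b] | a b i j. i + j = m \<and> a \<in> \<G> i \<and> b \<in> \<G> j}"
    using graded_comult[OF assms(1)] by auto
  then have "z \<in> formal_tensors 2" by (fastforce simp: formal_tensors_def)
  then have "sweedler2 h f = lin_ext s (\<lambda>xs. f (xs ! 0) (xs ! 1)) z" if "bilinear f" for f
    unfolding sweedler2_def z(1) by (rule tlift_tclass[OF multilinear_pair[OF that]])
  moreover have "lin_ext s (\<lambda>xs. g (xs ! 0) (xs ! 1)) z = lin_ext s (\<lambda>xs. g' (xs ! 0) (xs ! 1)) z"
    by (rule lin_ext_cong) (use z(2) assms(4) in fastforce)
  ultimately show ?thesis using assms by simp
qed

text \<open>In the comultiplication of an element of degree n, a left factor of degree i forces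
  degree n - i on the right. A projection of h is thus traded for one of the right factor, the form
  that an induction on the number of factors can use.\<close>

lemma sweedler2_hproj:
  assumes g: "bilinear g"
  shows "sweedler2 (hproj \<G> n h) (\<lambda>a b. g (hproj \<G> i a) b) =
    (if i \<le> n then sweedler2 h (\<lambda>a b. g (hproj \<G> i a) (hproj \<G> (n - i) b)) else 0)"
proof (rule linear_map_eqI[of s "\<lambda>h. sweedler2 (hproj \<G> n h) (\<lambda>a b. g (hproj \<G> i a) b)"])
  have g1: "bilinear (\<lambda>a b. g (hproj \<G> i a) b)"
    by (rule bilinear_comp[OF g linear_map_hproj linear_map_id])
  have g2: "bilinear (\<lambda>a b. g (hproj \<G> i a) (hproj \<G> j b))" for j
    by (rule bilinear_comp[OF g linear_map_hproj linear_map_hproj])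
  have g0: "bilinear (\<lambda>a b. 0)" by (simp add: bilinear_def linear_map_zero_const)
  have zero: "sweedler2 h (\<lambda>a b. 0) = 0" for h
    using sweedler2_sum[of h "\<lambda>_ _ _. 0" "{}"] by simp
  have z0: "g 0 b = 0" "g a 0 = 0" for a b
    using g by (simp_all add: bilinear_def linear_map_zero[of s s "\<lambda>a. g a b"] linear_map_zero[of s s "g a"])
  show "linear_map s s (\<lambda>h. sweedler2 (hproj \<G> n h) (\<lambda>a b. g (hproj \<G> i a) b))"
    by (rule linear_map_comp[OF linear_map_sweedler2[OF g1] linear_map_hproj])
  show "linear_map s s (\<lambda>h. if i \<le> n then sweedler2 h (\<lambda>a b. g (hproj \<G> i a) (hproj \<G> (n - i) b)) else 0)"
    using linear_map_sweedler2[OF g2] linear_map_zero_const by (cases "i \<le> n") auto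
  fix m h assume h: "h \<in> \<G> m"
  show "sweedler2 (hproj \<G> n h) (\<lambda>a b. g (hproj \<G> i a) b) =
    (if i \<le> n then sweedler2 h (\<lambda>a b. g (hproj \<G> i a) (hproj \<G> (n - i) b)) else 0)"
  proof (cases "n = m")
    case True
    have "sweedler2 h (\<lambda>a b. g (hproj \<G> i a) b) = sweedler2 h (\<lambda>a b. g (hproj \<G> i a) (hproj \<G> (m - i) b))"
      if "i \<le> m"
      by (rule sweedler2_homogeneous[OF h g1 g2]) (auto simp: hproj_homogeneous z0)
    moreover have "sweedler2 h (\<lambda>a b. g (hproj \<G> i a) b) = sweedler2 h (\<lambda>a b. 0)" if "\<not> i \<le> m"
      by (rule sweedler2_homogeneous[OF h g1 g0]) (use that in \<open>auto simp: hproj_homogeneous z0\<close>)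
    ultimately show ?thesis
      using True by (simp add: hproj_homogeneous[OF h] zero)
  next
    case False
    have "sweedler2 h (\<lambda>a b. g (hproj \<G> i a) (hproj \<G> (n - i) b)) = sweedler2 h (\<lambda>a b. 0)" if "i \<le> n"
      by (rule sweedler2_homogeneous[OF h g2 g0]) (use that False in \<open>auto simp: hproj_homogeneous z0\<close>)
    then show ?thesis
      using False by (simp add: hproj_homogeneous[OF h] zero linear_map_zero[OF linear_map_sweedler2[OF g1]])
  qed
qed

lemma sweedler_zero: "sweedler n h (\<lambda>_. 0) = 0"
  using sweedler_sum[of n h "\<lambda>_ _. 0" "{}"] by simp

lemma sweedler2_zero: "sweedler2 h (\<lambda>_ _. 0) = 0"
  using sweedler2_sum[of h "\<lambda>_ _ _. 0" "{}"] by simp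

text \<open>The last hypothesis says that \<open>f\<close> only depends on the components of degrees \<open>ns\<close> of its
  arguments; this avoids a sum over all distributions of the degree \<open>m\<close>.\<close>

lemma sweedler_hproj:
  "multilinear n f \<Longrightarrow> length ns = n \<Longrightarrow>
    (\<And>xs. length xs = n \<Longrightarrow> f (map2 (hproj \<G>) ns xs) = f xs) \<Longrightarrow>
    sweedler n (hproj \<G> m h) f = (if sum_list ns = m then sweedler n h f else 0)"
proof (induction n arbitrary: f ns m h)
  case 0
  then show ?case by (auto simp: sweedler_0 counit_hproj)
next
  case (Suc n)
  note f = Suc.prems(1)
  obtain d ds where ns: "ns = d # ds" "length ds = n"
    using Suc.prems(2) by (cases ns) auto
  have inv: "f (hproj \<G> d a # map2 (hproj \<G>) ds xs) = f (a # xs)" if "length xs = n" for a xs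
    using Suc.prems(3)[of "a # xs"] that ns by simp
  \<comment> \<open>Projections are idempotent. Comparing \<open>inv\<close> at an argument and at
    its projection therefore splits the joint invariance into invariance in the first slot and, in
    \<open>inv2\<close>, invariance in the remaining slots.\<close>
  have inv1: "f (hproj \<G> d a # xs) = f (a # xs)" if "length xs = n" for a xs
    using inv[OF that, of a] inv[OF that, of "hproj \<G> d a"] by (simp add: hproj_hproj)
  have inv2: "f (a # map2 (hproj \<G>) ds xs) = f (a # xs)" if "length xs = n" for a xs
    using inv[OF that, of a] inv[of "map2 (hproj \<G>) ds xs" a] that ns(2) by (simp add: map2_hproj_idem)
  define g where "g = (\<lambda>a b. sweedler n b (\<lambda>ys. f (a # ys)))"
  have g: "bilinear g"
    unfolding g_def by (rule bilinear_sweedler_Cons[OF f])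
  have g1: "g (hproj \<G> d a) b = g a b" for a b
    unfolding g_def by (rule sweedler_cong) (rule inv1)
  have g2: "g a (hproj \<G> e b) = (if sum_list ds = e then g a b else 0)" for a b e
    unfolding g_def by (rule Suc.IH[OF multilinear_Cons[OF f] ns(2) inv2])
  have "sweedler (Suc n) (hproj \<G> m h) f = (if d \<le> m then sweedler2 h (\<lambda>a b. g a (hproj \<G> (m - d) b)) else 0)"
    using sweedler2_hproj[OF g, of m h d] by (simp add: sweedler_Suc[OF f] g1 flip: g_def)
  also have "\<dots> = (if d + sum_list ds = m then sweedler2 h g else 0)"
    by (cases "d \<le> m"; cases "sum_list ds = m - d") (auto simp: g2 sweedler2_zero)
  finally show ?case
    by (simp add: sweedler_Suc[OF f] ns g_def)
qed

text \<open>\<open>sweedler_hproj\<close> applied to each entry: the projection of entry j either is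
  redundant or kills the sum, depending on whether the degrees in row j of \<open>nss\<close> add up
  to entry j of \<open>ms\<close>. As there, idempotence splits the joint invariance of
  \<open>f\<close> into invariance in the first row and in the others.\<close>

lemma sweedler_list_hproj:
  assumes "length nss = length hs" "length ms = length hs" "\<forall>ns\<in>set nss. length ns = n"
    and "multilinear_rows n (length hs) f"
    and "\<And>xss. rectangular (length hs) n xss \<Longrightarrow> f (map2 (map2 (hproj \<G>)) nss xss) = f xss"
  shows "sweedler_list n (map2 (hproj \<G>) ms hs) f =
    (if map sum_list nss = ms then sweedler_list n hs f else 0)"
  using assms
proof (induction hs arbitrary: nss ms f)
  case (Cons h hs nss' ms')
  obtain ns nss m ms where eqs: "nss' = ns # nss" "ms' = m # ms"
    using Cons.prems(1,2) by (cases nss'; cases ms') auto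
  note prems = Cons.prems[unfolded eqs]
  let ?l = "length hs"
  have len: "length ns = n" using prems by simp
  have f1: "multilinear n (\<lambda>xs. f (xs # xss))" if "rectangular ?l n xss" for xss
    using prems(4) that by simp
  have f2: "multilinear_rows n ?l (\<lambda>xss. f (xs # xss))" if "length xs = n" for xs
    using prems(4) that by simp
  have rect: "rectangular ?l n (map2 (map2 (hproj \<G>)) nss xss)" if "rectangular ?l n xss" for xss
  proof -
    have "length a = n \<and> length b = n" if "(a, b) \<in> set (zip nss xss)" for a b
      using set_zip_leftD[OF that] set_zip_rightD[OF that] \<open>rectangular ?l n xss\<close> prems(3)
      by (simp add: rectangular_def)
    then show ?thesis
      using that prems(1) by (auto simp: rectangular_def)
  qed
  have inv: "f (map2 (hproj \<G>) ns xs # map2 (map2 (hproj \<G>)) nss xss) = f (xs # xss)"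
    if "length xs = n" "rectangular ?l n xss" for xs xss
    using prems(5)[of "xs # xss"] that by (simp add: rectangular_Cons)
  have idem: "map2 (map2 (hproj \<G>)) nss (map2 (map2 (hproj \<G>)) nss xss) = map2 (map2 (hproj \<G>)) nss xss"
    for xss
  proof (induction nss arbitrary: xss)
    case (Cons ns nss)
    then show ?case by (cases xss) (simp_all add: map2_hproj_idem)
  qed simp
  have inv1: "f (map2 (hproj \<G>) ns xs # xss) = f (xs # xss)"
    if "length xs = n" "rectangular ?l n xss" for xs xss
    using inv[OF that] inv[of "map2 (hproj \<G>) ns xs" xss] that len by (simp add: map2_hproj_idem)
  have inv2: "f (xs # map2 (map2 (hproj \<G>)) nss xss) = f (xs # xss)"
    if "length xs = n" "rectangular ?l n xss" for xs xss
    using inv[OF that] inv[OF that(1) rect[OF that(2)]] by (simp add: idem)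
  have "sweedler_list n (map2 (hproj \<G>) (m # ms) (h # hs)) f =
      sweedler n (hproj \<G> m h) (\<lambda>xs. sweedler_list n (map2 (hproj \<G>) ms hs) (\<lambda>xss. f (xs # xss)))"
    by simp
  also have "\<dots> = sweedler n (hproj \<G> m h)
      (\<lambda>xs. if map sum_list nss = ms then sweedler_list n hs (\<lambda>xss. f (xs # xss)) else 0)"
    by (rule sweedler_cong, rule Cons.IH) (use prems f2 inv2 in auto)
  also have "\<dots> = (if map sum_list nss = ms
      then sweedler n (hproj \<G> m h) (\<lambda>xs. sweedler_list n hs (\<lambda>xss. f (xs # xss))) else 0)"
    by (simp add: sweedler_zero)
  also have "sweedler n (hproj \<G> m h) (\<lambda>xs. sweedler_list n hs (\<lambda>xss. f (xs # xss))) =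
      (if sum_list ns = m then sweedler n h (\<lambda>xs. sweedler_list n hs (\<lambda>xss. f (xs # xss))) else 0)"
    by (rule sweedler_hproj)
      (auto intro!: multilinear_sweedler_list_fun sweedler_list_cong f1 simp: len inv1)
  finally show ?case by (simp add: eqs)
qed simp_all

end

section \<open>Permutations\<close>

lemma finite_inj_permutes:
  assumes "finite S" "inj_on p S" "\<And>x. x \<in> S \<Longrightarrow> p x \<in> S" "\<And>x. x \<notin> S \<Longrightarrow> p x = x"
  shows "p permutes S"
proof (rule bij_imp_permutes)
  show "bij_betw p S S"
    using assms endo_inj_surj[of S p] by (auto simp: bij_betw_def)
qed (rule assms)

lemma permutes_range:
  assumes "\<sigma> permutes {1..k}" "1 \<le> i" "i \<le> k"
  shows "1 \<le> \<sigma> i" "\<sigma> i \<le> k"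
  using permutes_in_image[OF assms(1), of i] assms(2,3) by simp_all

text \<open>Conjugation by the shift: permutations act on \<open>{1..k}\<close>, but
  \<open>!\<close> counts from 0.\<close>

definition zero_based :: "(nat \<Rightarrow> nat) \<Rightarrow> nat \<Rightarrow> nat" where
  "zero_based \<sigma> i = \<sigma> (Suc i) - 1"

lemma zero_based_permutes:
  assumes "\<sigma> permutes {1..k}"
  shows "zero_based \<sigma> permutes {..<k}"
proof (rule finite_inj_permutes)
  show "inj_on (zero_based \<sigma>) {..<k}"
  proof (rule inj_onI)
    fix i j assume "i \<in> {..<k}" "j \<in> {..<k}" "zero_based \<sigma> i = zero_based \<sigma> j"
    then have "\<sigma> (Suc i) = \<sigma> (Suc j)"
      using permutes_range[OF assms, of "Suc i"] permutes_range[OF assms, of "Suc j"]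
      by (simp add: zero_based_def)
    then show "i = j" using inj_eq[OF permutes_inj[OF assms]] by simp
  qed
  show "zero_based \<sigma> i \<in> {..<k}" if "i \<in> {..<k}" for i
    using permutes_range[OF assms, of "Suc i"] that by (simp add: zero_based_def)
  show "zero_based \<sigma> i = i" if "i \<notin> {..<k}" for i
    using permutes_not_in[OF assms, of "Suc i"] that by (simp add: zero_based_def)
qed simp

lemma perm_oplus_permutes:
  assumes \<sigma>: "\<sigma> permutes {1..k}" and \<tau>: "\<tau> permutes {1..l}"
  shows "perm_oplus k \<sigma> \<tau> permutes {1..k + l}"
proof (rule finite_inj_permutes)
  have s: "\<sigma> n \<le> k" if "n \<le> k" for n
    using permutes_range[OF \<sigma>, of n] permutes_not_in[OF \<sigma>, of n] that by (cases "n = 0") auto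
  \<comment> \<open>Together with \<open>s\<close> this keeps the two blocks apart: images of the
    second block exceed \<open>k\<close>, those of the first do not.\<close>
  have t: "0 < \<tau> n" if "0 < n" for n
    using permutes_range[OF \<tau>, of n] permutes_not_in[OF \<tau>, of n] that by (cases "n \<le> l") auto
  have inj: "\<sigma> m = \<sigma> n \<longleftrightarrow> m = n" "\<tau> m = \<tau> n \<longleftrightarrow> m = n" for m n
    using inj_eq[OF permutes_inj[OF \<sigma>]] inj_eq[OF permutes_inj[OF \<tau>]] by auto
  show "inj_on (perm_oplus k \<sigma> \<tau>) {1..k + l}"
  proof (rule inj_onI)
    fix m n assume "perm_oplus k \<sigma> \<tau> m = perm_oplus k \<sigma> \<tau> n"
    then show "m = n"
      using s[of m] s[of n] t[of "m - k"] t[of "n - k"] inj(1)[of m n] inj(2)[of "m - k" "n - k"]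
      by (auto simp: perm_oplus_def split: if_splits)
  qed
  show "perm_oplus k \<sigma> \<tau> n \<in> {1..k + l}" if "n \<in> {1..k + l}" for n
  proof (cases "n \<le> k")
    case True
    then show ?thesis using that permutes_range[OF \<sigma>, of n] by (simp add: perm_oplus_def)
  next
    case False
    then have "1 \<le> n - k" "n - k \<le> l" using that by auto
    then show ?thesis using False permutes_range[OF \<tau>, of "n - k"] by (simp add: perm_oplus_def)
  qed
  show "perm_oplus k \<sigma> \<tau> n = n" if "n \<notin> {1..k + l}" for n
  proof (cases "n = 0")
    case True
    then show ?thesis using permutes_not_in[OF \<sigma>, of 0] by (simp add: perm_oplus_def)
  next
    case False
    then have "k + l < n" using that by simp
    moreover from this have "n - k \<notin> {1..l}" by auto
    ultimately show ?thesis using permutes_not_in[OF \<tau>] by (simp add: perm_oplus_def)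
  qed
qed simp

lemma perm_bracket_block:
  assumes "i < k" "j < l"
  shows "perm_bracket k l \<tau> \<sigma> (Suc (l * i + j)) = k * zero_based \<tau> j + \<sigma> (Suc i)"
proof -
  have "l * i + j < l * Suc i" using assms(2) by simp
  also have "\<dots> \<le> l * k" using assms(1) by (intro mult_le_mono) auto
  finally have "l * i + j < k * l" by (simp add: mult.commute)
  then show ?thesis
    using assms by (simp add: perm_bracket_def zero_based_def)
qed

lemma block_index:
  assumes "n < k * (l::nat)"
  obtains i j where "i < k" "j < l" "n = l * i + j"
proof
  have "0 < l" using assms by (cases l) auto
  then show "n mod l < l" by simp
  show "n div l < k" using assms by (simp add: less_mult_imp_div_less)
  show "n = l * (n div l) + n mod l" by simp
qed

lemma block_index_unique:
  assumes "k * a + b = k * a' + b'" "b < (k::nat)" "b' < k"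
  shows "a = a'" "b = b'"
proof -
  have "(k * a + b) div k = (k * a' + b') div k" "(k * a + b) mod k = (k * a' + b') mod k"
    using assms(1) by simp_all
  then show "a = a'" "b = b'" using assms(2,3) by simp_all
qed

text \<open>Counting from 0, the input has quotient i and remainder j modulo l, while the output has
  quotient \<tau>(j) and remainder \<sigma>(i) modulo k. Uniqueness of division with remainder gives
  injectivity, which suffices on a finite set.\<close>

lemma perm_bracket_permutes:
  assumes \<sigma>: "\<sigma> permutes {1..k}" and \<tau>: "\<tau> permutes {1..l}"
  shows "perm_bracket k l \<tau> \<sigma> permutes {1..k * l}"
proof (rule finite_inj_permutes)
  have block: "\<exists>i j. i < k \<and> j < l \<and> n = Suc (l * i + j)" if "n \<in> {1..k * l}" for n
    using that block_index[of "n - 1" k l] by (metis Suc_diff_1 Suc_le_eq atLeastAtMost_iff One_nat_def)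
  have zt: "zero_based \<tau> j < l" if "j < l" for j
    using permutes_in_image[OF zero_based_permutes[OF \<tau>], of j] that by simp
  have zs: "zero_based \<sigma> i < k" "\<sigma> (Suc i) = Suc (zero_based \<sigma> i)" if "i < k" for i
    using permutes_in_image[OF zero_based_permutes[OF \<sigma>], of i] permutes_range[OF \<sigma>, of "Suc i"] that
    by (simp_all add: zero_based_def)
  show "inj_on (perm_bracket k l \<tau> \<sigma>) {1..k * l}"
  proof (rule inj_onI)
    fix m n assume "m \<in> {1..k * l}" "n \<in> {1..k * l}" and eq: "perm_bracket k l \<tau> \<sigma> m = perm_bracket k l \<tau> \<sigma> n"
    then obtain i j i' j' where *: "i < k" "j < l" "m = Suc (l * i + j)" "i' < k" "j' < l" "n = Suc (l * i' + j')"
      using block by meson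
    then have "k * zero_based \<tau> j + zero_based \<sigma> i = k * zero_based \<tau> j' + zero_based \<sigma> i'"
      using eq by (simp add: perm_bracket_block zs)
    then have "zero_based \<tau> j = zero_based \<tau> j'" "zero_based \<sigma> i = zero_based \<sigma> i'"
      using block_index_unique zs(1) * by metis+
    then have "j = j'" "i = i'"
      using inj_eq[OF permutes_inj[OF zero_based_permutes[OF \<tau>]]]
        inj_eq[OF permutes_inj[OF zero_based_permutes[OF \<sigma>]]] by auto
    then show "m = n" using * by simp
  qed
  show "perm_bracket k l \<tau> \<sigma> n \<in> {1..k * l}" if n: "n \<in> {1..k * l}" for n
  proof -
    obtain i j where *: "i < k" "j < l" "n = Suc (l * i + j)" using block[OF n] by auto
    have "k * zero_based \<tau> j + \<sigma> (Suc i) \<le> k * Suc (zero_based \<tau> j)"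
      using zs[OF *(1)] by simp
    also have "\<dots> \<le> k * l"
      using zt[OF *(2)] by (intro mult_le_mono) auto
    finally show ?thesis
      using * zs by (simp add: perm_bracket_block)
  qed
  show "perm_bracket k l \<tau> \<sigma> n = n" if "n \<notin> {1..k * l}" for n
    using that by (auto simp: perm_bracket_def)
qed simp

text \<open>\<open>standardization\<close> is a definite description, so existence and uniqueness
  are both required. The rank function has the defining property. Conversely, a permutation \<sigma>
  with that property satisfies \<sigma>(a) = number of c with \<sigma>(c) \<le> \<sigma>(a), and the
  property turns this count into the rank.\<close>

lemma standardization_distinct:
  fixes w :: "'a::linorder list"
  assumes w: "distinct w"
  shows "standardization w permutes {1..length w}"
    and "a \<in> {1..length w} \<Longrightarrow>
      standardization w a = card {c \<in> {1..length w}. w ! (c - 1) \<le> w ! (a - 1)}"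
proof -
  let ?I = "{1..length w}"
  let ?v = "\<lambda>c. w ! (c - 1)"
  let ?P = "\<lambda>\<sigma>. \<sigma> permutes ?I \<and>
    (\<forall>a b. 1 \<le> a \<and> a < b \<and> b \<le> length w \<longrightarrow> (\<sigma> a < \<sigma> b \<longleftrightarrow> ?v a \<le> ?v b))"
  define r where "r = (\<lambda>a. if a \<in> ?I then card {c \<in> ?I. ?v c \<le> ?v a} else a)"
  have v: "?v a = ?v b \<longleftrightarrow> a = b" if "a \<in> ?I" "b \<in> ?I" for a b
  proof -
    have "a - 1 < length w" "b - 1 < length w" using that by auto
    then show ?thesis using that nth_eq_iff_index_eq[OF w, of "a - 1" "b - 1"] by auto
  qed
  have mono: "r a < r b" if "a \<in> ?I" "b \<in> ?I" "?v a < ?v b" for a b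
  proof -
    have "b \<in> {c \<in> ?I. ?v c \<le> ?v b} - {c \<in> ?I. ?v c \<le> ?v a}" using that by auto
    moreover have "{c \<in> ?I. ?v c \<le> ?v a} \<subseteq> {c \<in> ?I. ?v c \<le> ?v b}" using that(3) by auto
    ultimately have "{c \<in> ?I. ?v c \<le> ?v a} \<subset> {c \<in> ?I. ?v c \<le> ?v b}" by blast
    then have "card {c \<in> ?I. ?v c \<le> ?v a} < card {c \<in> ?I. ?v c \<le> ?v b}"
      by (intro psubset_card_mono) auto
    then show ?thesis using that(1,2) by (simp add: r_def)
  qed
  have r_permutes: "r permutes ?I"
  proof (rule finite_inj_permutes)
    show "inj_on r ?I"
    proof (rule inj_onI)
      fix a b assume "a \<in> ?I" "b \<in> ?I" "r a = r b"
      then show "a = b" using mono[of a b] mono[of b a] v[of a b] by (metis less_irrefl neqE)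
    qed
    fix a assume a: "a \<in> ?I"
    define N where "N = card {c \<in> ?I. ?v c \<le> ?v a}"
    have "{c \<in> ?I. ?v c \<le> ?v a} \<noteq> {}" using a by auto
    then have "N \<noteq> 0" by (simp add: N_def card_eq_0_iff)
    moreover have "N \<le> card ?I" unfolding N_def by (rule card_mono) auto
    moreover have "r a = N" using a by (simp add: r_def N_def)
    ultimately show "r a \<in> ?I" by simp
  qed (auto simp: r_def)
  have "r a < r b \<longleftrightarrow> ?v a \<le> ?v b" if "1 \<le> a" "a < b" "b \<le> length w" for a b
  proof -
    have "?v a \<noteq> ?v b" using v[of a b] that by auto
    then show ?thesis using mono[of a b] mono[of b a] that by (cases rule: linorder_cases[of "?v a" "?v b"]) auto
  qed
  then have P: "?P r" using r_permutes by auto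
  have unique: "\<sigma> = r" if "?P \<sigma>" for \<sigma>
  proof
    fix a
    have perm: "\<sigma> permutes ?I" and
      ord: "\<And>a b. 1 \<le> a \<Longrightarrow> a < b \<Longrightarrow> b \<le> length w \<Longrightarrow> \<sigma> a < \<sigma> b \<longleftrightarrow> ?v a \<le> ?v b"
      using that by auto
    have le: "\<sigma> c \<le> \<sigma> a \<longleftrightarrow> ?v c \<le> ?v a" if ac: "a \<in> ?I" "c \<in> ?I" for c
    proof -
      have ne: "\<sigma> c \<noteq> \<sigma> a" "?v c \<noteq> ?v a" if "c \<noteq> a"
        using that ac v[of c a] inj_eq[OF permutes_inj[OF perm]] by auto
      consider "c < a" | "c = a" | "a < c" by linarith
      then show ?thesis
      proof cases
        case 1
        then show ?thesis using ne(1) ord[of c a] ac by (simp add: order_le_less)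
      next
        case 3
        then have "\<sigma> a < \<sigma> c \<longleftrightarrow> ?v a < ?v c"
          using ne(2) ord[of a c] ac by (simp add: order_less_le)
        then show ?thesis by (simp only: linorder_not_less[symmetric])
      qed simp
    qed
    show "\<sigma> a = r a"
    proof (cases "a \<in> ?I")
      case True
      \<comment> \<open>A permutation attains each of the values from 1 to \<sigma>(a) exactly once,
        so counting the arguments with these values recovers \<sigma>(a).\<close>
      have "\<sigma> ` {c \<in> ?I. \<sigma> c \<le> \<sigma> a} = {1..\<sigma> a}"
      proof (intro equalityI subsetI)
        fix x assume "x \<in> {1..\<sigma> a}"
        moreover from this have "x \<in> \<sigma> ` ?I"
          using permutes_in_image[OF perm, of a] True unfolding permutes_image[OF perm] by simp
        ultimately show "x \<in> \<sigma> ` {c \<in> ?I. \<sigma> c \<le> \<sigma> a}" by auto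
      next
        fix x assume "x \<in> \<sigma> ` {c \<in> ?I. \<sigma> c \<le> \<sigma> a}"
        then show "x \<in> {1..\<sigma> a}" using permutes_in_image[OF perm] by auto
      qed
      moreover have "card (\<sigma> ` {c \<in> ?I. \<sigma> c \<le> \<sigma> a}) = card {c \<in> ?I. \<sigma> c \<le> \<sigma> a}"
        by (rule card_image) (rule inj_on_subset[OF permutes_inj[OF perm]], simp)
      ultimately have "\<sigma> a = card {c \<in> ?I. \<sigma> c \<le> \<sigma> a}" by simp
      also have "{c \<in> ?I. \<sigma> c \<le> \<sigma> a} = {c \<in> ?I. ?v c \<le> ?v a}" using le[OF True] by auto
      finally show ?thesis using True by (simp add: r_def)
    next
      case False
      then show ?thesis using permutes_not_in[OF perm False] by (simp only: r_def if_False)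
    qed
  qed
  have "standardization w = r"
    unfolding standardization_def by (rule the_equality) (use P unique in blast)+
  then show "standardization w permutes ?I"
    and "a \<in> ?I \<Longrightarrow> standardization w a = card {c \<in> ?I. ?v c \<le> ?v a}"
    using r_permutes by (simp_all add: r_def)
qed

text \<open>\<open>nths\<close> preserves the order, so the new index of entry m is the number of
  selected positions before it.\<close>

lemma nth_nths:
  assumes "m \<in> S" "m < length xs"
  shows "nths xs S ! card {i \<in> S. i < m} = xs ! m"
proof -
  have "nths xs S = nths (take m xs @ xs ! m # drop (Suc m) xs) S"
    using assms(2) by (simp add: id_take_nth_drop[symmetric])
  also have "\<dots> = nths (take m xs) S @ xs ! m # nths (drop (Suc m) xs) {j. Suc j + m \<in> S}"
    using assms by (simp add: nths_append nths_Cons)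
  finally have eq: "nths xs S = nths (take m xs) S @ xs ! m # nths (drop (Suc m) xs) {j. Suc j + m \<in> S}" .
  have "length (nths (take m xs) S) = card {i \<in> S. i < m}"
    using assms(2) by (auto simp: length_nths intro!: arg_cong[of _ _ card])
  then show ?thesis
    unfolding eq by (metis nth_append_length)
qed

lemma nth_concat_rectangular:
  "rectangular l n xss \<Longrightarrow> i < l \<Longrightarrow> j < n \<Longrightarrow> concat xss ! (n * i + j) = xss ! i ! j"
proof (induction xss arbitrary: l i)
  case (Cons xs xss)
  then obtain l' where "l = Suc l'" "rectangular l' n xss" "length xs = n"
    by (cases l) (auto simp: rectangular_def)
  with Cons show ?case by (cases i) (auto simp: nth_append)
qed (simp add: rectangular_def)

lemma prod_list_blocks:
  fixes g :: "nat \<Rightarrow> 'a::monoid_mult"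
  shows "prod_list (map g [0..<k * l]) = prod_list (map (\<lambda>i. prod_list (map (\<lambda>j. g (l * i + j)) [0..<l])) [0..<k])"
proof (induction k)
  case (Suc k)
  have "[0..<Suc k * l] = [0..<k * l] @ map (\<lambda>j. k * l + j) [0..<l]"
    using upt_add_eq_append[of 0 "k * l" l] map_add_upt[of "k * l" l] by (simp add: add.commute)
  then show ?case by (simp add: Suc comp_def mult.commute)
qed simp

text \<open>The factors need not commute, so the last one is split off, in accordance with
  \<open>[0..<Suc k]\<close>. Choices of summands are recorded as lists; when the summands are
  indexed by weak compositions, such a list is a matrix given by its rows.\<close>

lemma prod_list_sum_distrib:
  fixes g :: "nat \<Rightarrow> 'c \<Rightarrow> 'a::{semiring_0, monoid_mult}"
  assumes "\<And>i. finite (C i)"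
  shows "prod_list (map (\<lambda>i. \<Sum>c\<in>C i. g i c) [0..<k]) =
    (\<Sum>\<gamma> | length \<gamma> = k \<and> (\<forall>i<k. \<gamma> ! i \<in> C i). prod_list (map (\<lambda>i. g i (\<gamma> ! i)) [0..<k]))"
proof (induction k)
  case 0
  have "{\<gamma> :: 'c list. length \<gamma> = 0 \<and> (\<forall>i<0. \<gamma> ! i \<in> C i)} = {[]}" by auto
  then show ?case by simp
next
  case (Suc k)
  let ?A = "\<lambda>k. {\<gamma>. length \<gamma> = k \<and> (\<forall>i<k. \<gamma> ! i \<in> C i)}"
  have "prod_list (map (\<lambda>i. \<Sum>c\<in>C i. g i c) [0..<Suc k]) =
      (\<Sum>(\<gamma>, c)\<in>?A k \<times> C k. prod_list (map (\<lambda>i. g i (\<gamma> ! i)) [0..<k]) * g k c)"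
    by (simp add: Suc sum_product sum.cartesian_product)
  also have "\<dots> = (\<Sum>\<gamma>\<in>?A (Suc k). prod_list (map (\<lambda>i. g i (\<gamma> ! i)) [0..<Suc k]))"
  proof (rule sum.reindex_bij_witness[where i = "\<lambda>\<gamma>. (butlast \<gamma>, last \<gamma>)" and j = "\<lambda>(\<gamma>, c). \<gamma> @ [c]"])
    fix p assume "p \<in> ?A k \<times> C k"
    then obtain \<gamma> c where p: "p = (\<gamma>, c)" "length \<gamma> = k" "\<forall>i<k. \<gamma> ! i \<in> C i" "c \<in> C k" by auto
    have eq: "map (\<lambda>i. g i ((\<gamma> @ [c]) ! i)) [0..<k] = map (\<lambda>i. g i (\<gamma> ! i)) [0..<k]"
      using p by (intro map_cong) (auto simp: nth_append)
    have "(\<gamma> @ [c]) ! k = c"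
      using p by (simp add: nth_append)
    then show "prod_list (map (\<lambda>i. g i ((case p of (\<gamma>, c) \<Rightarrow> \<gamma> @ [c]) ! i)) [0..<Suc k]) =
        (case p of (\<gamma>, c) \<Rightarrow> prod_list (map (\<lambda>i. g i (\<gamma> ! i)) [0..<k]) * g k c)"
      by (simp add: p(1) eq)
    show "(case p of (\<gamma>, c) \<Rightarrow> \<gamma> @ [c]) \<in> ?A (Suc k)"
      using p by (auto simp: nth_append less_Suc_eq)
    show "(butlast (case p of (\<gamma>, c) \<Rightarrow> \<gamma> @ [c]), last (case p of (\<gamma>, c) \<Rightarrow> \<gamma> @ [c])) = p"
      using p by simp
  next
    fix \<gamma> assume *: "\<gamma> \<in> ?A (Suc k)"
    then have "\<gamma> \<noteq> []" by auto
    then show "(case (butlast \<gamma>, last \<gamma>) of (\<gamma>, c) \<Rightarrow> \<gamma> @ [c]) = \<gamma>" by simp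
    show "(butlast \<gamma>, last \<gamma>) \<in> ?A k \<times> C k"
      using * \<open>\<gamma> \<noteq> []\<close> by (auto simp: nth_butlast last_conv_nth)
  qed
  finally show ?case .
qed

section \<open>The maps \<open>p\<^sub>\<alpha>\<^sub>,\<^sub>\<sigma>\<close>\<close>

context connected_graded_bialgebra
begin

text \<open>The multilinear map evaluated by \<open>p\<^sub>\<alpha>\<^sub>,\<^sub>\<sigma>\<close> on the terms of the iterated comultiplication;
  here \<open>\<rho>\<close> is \<open>\<sigma>\<close> acting on the positions \<open>0, \<dots>, k - 1\<close>.\<close>

definition permuted_product :: "nat list \<Rightarrow> (nat \<Rightarrow> nat) \<Rightarrow> 'h list \<Rightarrow> 'h" where
  "permuted_product \<alpha> \<rho> xs = prod_list (map (\<lambda>i. hproj \<G> (\<alpha> ! i) (xs ! \<rho> i)) [0..<length \<alpha>])"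

lemma multilinear_permuted_product:
  assumes "\<rho> permutes {..<length \<alpha>}"
  shows "multilinear (length \<alpha>) (permuted_product \<alpha> \<rho>)"
proof (rule multilinear_cong)
  show "multilinear (length \<alpha>)
      (\<lambda>xs. prod_list (map2 (hproj \<G>) \<alpha> (map (\<lambda>i. xs ! \<rho> i) [0..<length \<alpha>])))"
    by (rule multilinear_permute[OF multilinear_map2[OF multilinear_prod_list] assms])
      (simp_all add: linear_map_hproj)
  show "permuted_product \<alpha> \<rho> xs = prod_list (map2 (hproj \<G>) \<alpha> (map (\<lambda>i. xs ! \<rho> i) [0..<length \<alpha>]))"
    for xs
    unfolding permuted_product_def by (intro arg_cong[of _ _ prod_list] nth_equalityI) auto
qed

lemma p_map_sweedler:
  assumes \<sigma>: "\<sigma> permutes {1..length \<alpha>}"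
  shows "p_map s \<Delta> \<epsilon> \<G> \<alpha> \<sigma> h = sweedler (length \<alpha>) h (permuted_product \<alpha> (zero_based \<sigma>))"
proof -
  let ?k = "length \<alpha>"
  let ?A = "iter_comult s \<Delta> \<epsilon> ?k h"
  let ?f = "\<lambda>xs. prod_list (map2 (\<lambda>f x. f x) (map (hproj \<G>) \<alpha>) xs)"
  have f: "multilinear ?k ?f"
    by (rule multilinear_map2[OF multilinear_prod_list]) (auto simp: linear_map_hproj)
  have ml: "multilinear (length (map (hproj \<G>) \<alpha>)) prod_list"
    by (rule multilinear_prod_list)
  have closed: "perm_act s ?k (inv \<sigma>) ?A \<in> tensor_power s (length (map (hproj \<G>) \<alpha>))"
    using tensor_power_perm_act[OF tensor_power_iter_comult] by simp
  have "p_map s \<Delta> \<epsilon> \<G> \<alpha> \<sigma> h = tlift s ?f (perm_act s ?k (inv \<sigma>) ?A)"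
    unfolding p_map_def iter_mult_def comp_def by (rule tlift_tensor_maps[OF ml closed])
  also have "\<dots> = tlift s (\<lambda>xs. ?f (map (\<lambda>i. xs ! (inv (inv \<sigma>) i - 1)) [1..<?k + 1])) ?A"
    by (rule tlift_perm_act[OF f tensor_power_iter_comult])
  \<comment> \<open>The inverse in \<open>p_map\<close> cancels the one in \<open>perm_act\<close>:
    slot i of the product receives the factor at position \<sigma>(i).\<close>
  also have "(\<lambda>xs. ?f (map (\<lambda>i. xs ! (inv (inv \<sigma>) i - 1)) [1..<?k + 1])) = permuted_product \<alpha> (zero_based \<sigma>)"
    unfolding permuted_product_def zero_based_def permutes_inv_inv[OF \<sigma>]
    by (intro ext arg_cong[of _ _ prod_list] nth_equalityI) (auto simp del: upt_Suc)
  finally show ?thesis by (simp add: sweedler_def)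
qed

lemma linear_map_p_map:
  "\<sigma> permutes {1..length \<alpha>} \<Longrightarrow> linear_map s s (p_map s \<Delta> \<epsilon> \<G> \<alpha> \<sigma>)"
  using linear_map_sweedler[OF multilinear_permuted_product[OF zero_based_permutes]]
  by (simp add: linear_map_def p_map_sweedler)

section \<open>External products and convolution\<close>

lemma p_map_append:
  assumes \<sigma>: "\<sigma> permutes {1..length \<alpha>}" and \<tau>: "\<tau> permutes {1..length \<beta>}"
  shows "p_map s \<Delta> \<epsilon> \<G> (\<alpha> @ \<beta>) (perm_oplus (length \<alpha>) \<sigma> \<tau>) =
    convolution s \<Delta> (p_map s \<Delta> \<epsilon> \<G> \<alpha> \<sigma>) (p_map s \<Delta> \<epsilon> \<G> \<beta> \<tau>)"
proof
  fix h
  let ?k = "length \<alpha>" and ?l = "length \<beta>"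
  let ?P = "permuted_product \<alpha> (zero_based \<sigma>)" and ?Q = "permuted_product \<beta> (zero_based \<tau>)"
  let ?R = "permuted_product (\<alpha> @ \<beta>) (zero_based (perm_oplus ?k \<sigma> \<tau>))"
  have perm: "perm_oplus ?k \<sigma> \<tau> permutes {1..length (\<alpha> @ \<beta>)}"
    using perm_oplus_permutes[OF \<sigma> \<tau>] by simp
  have R: "multilinear (?k + ?l) ?R"
    using multilinear_permuted_product[OF zero_based_permutes[OF perm]] by simp
  \<comment> \<open>\<open>perm_oplus\<close> keeps the first k and the last l positions apart, so
    the first k slots only read \<open>xs\<close> and the others only \<open>ys\<close>.\<close>
  have split: "?R (xs @ ys) = ?P xs * ?Q ys" if xs: "length xs = ?k" for xs ys
  proof -
    let ?g = "\<lambda>i. hproj \<G> ((\<alpha> @ \<beta>) ! i) ((xs @ ys) ! zero_based (perm_oplus ?k \<sigma> \<tau>) i)"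
    have upt: "[0..<?k + ?l] = [0..<?k] @ map (\<lambda>j. ?k + j) [0..<?l]"
      using upt_add_eq_append[of 0 ?k ?l] map_add_upt[of ?k ?l] by (simp add: add.commute)
    have 1: "?g i = hproj \<G> (\<alpha> ! i) (xs ! zero_based \<sigma> i)" if "i < ?k" for i
    proof -
      have "zero_based \<sigma> i < ?k"
        using permutes_in_image[OF zero_based_permutes[OF \<sigma>], of i] that by simp
      then show ?thesis
        using that xs by (simp add: nth_append zero_based_def perm_oplus_def)
    qed
    have 2: "?g (?k + j) = hproj \<G> (\<beta> ! j) (ys ! zero_based \<tau> j)" if "j < ?l" for j
    proof -
      have "\<tau> (Suc j) = Suc (zero_based \<tau> j)"
        using permutes_range[OF \<tau>, of "Suc j"] that by (simp add: zero_based_def)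
      then have "zero_based (perm_oplus ?k \<sigma> \<tau>) (?k + j) = ?k + zero_based \<tau> j"
        by (simp add: zero_based_def[of "perm_oplus ?k \<sigma> \<tau>"] perm_oplus_def)
      then show ?thesis
        using xs by (simp add: nth_append)
    qed
    have "map ?g [0..<?k + ?l] = map (\<lambda>i. hproj \<G> (\<alpha> ! i) (xs ! zero_based \<sigma> i)) [0..<?k] @
        map (\<lambda>j. hproj \<G> (\<beta> ! j) (ys ! zero_based \<tau> j)) [0..<?l]"
      unfolding upt map_append map_map comp_def using 1 2 by (intro arg_cong2[of _ _ _ _ append] map_cong) auto
    then show ?thesis by (simp add: permuted_product_def)
  qed
  have "p_map s \<Delta> \<epsilon> \<G> (\<alpha> @ \<beta>) (perm_oplus ?k \<sigma> \<tau>) h =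
      sweedler2 h (\<lambda>a b. sweedler ?k a (\<lambda>xs. sweedler ?l b (\<lambda>ys. ?R (xs @ ys))))"
    using sweedler_append[OF R] by (simp add: p_map_sweedler[OF perm])
  also have "\<dots> = sweedler2 h (\<lambda>a b. sweedler ?k a (\<lambda>xs. sweedler ?l b (\<lambda>ys. ?P xs * ?Q ys)))"
    by (simp add: split cong: sweedler_cong)
  \<comment> \<open>Multiplication by a fixed element is linear and can be pulled out of each of the
    two sums in turn.\<close>
  also have "\<dots> = sweedler2 h (\<lambda>a b. sweedler ?k a ?P * sweedler ?l b ?Q)"
  proof -
    have "sweedler ?k a ?P * c = sweedler ?k a (\<lambda>xs. ?P xs * c)" for a c
      by (rule linear_map_apply_sweedler[OF linear_map_mult_left[OF linear_map_id]])
    then have "sweedler ?k a ?P * sweedler ?l b ?Q = sweedler ?k a (\<lambda>xs. ?P xs * sweedler ?l b ?Q)" for a b .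
    moreover have "c * sweedler ?l b ?Q = sweedler ?l b (\<lambda>ys. c * ?Q ys)" for b c
      by (rule linear_map_apply_sweedler[OF linear_map_mult_right[OF linear_map_id]])
    ultimately have "sweedler ?k a ?P * sweedler ?l b ?Q =
        sweedler ?k a (\<lambda>xs. sweedler ?l b (\<lambda>ys. ?P xs * ?Q ys))" for a b
      by (simp only:)
    then show ?thesis by simp
  qed
  also have "\<dots> = convolution s \<Delta> (p_map s \<Delta> \<epsilon> \<G> \<alpha> \<sigma>) (p_map s \<Delta> \<epsilon> \<G> \<beta> \<tau>) h"
    unfolding convolution_sweedler2[OF linear_map_p_map[OF \<sigma>] linear_map_p_map[OF \<tau>]]
    by (simp only: p_map_sweedler[OF \<sigma>] p_map_sweedler[OF \<tau>])
  finally show "p_map s \<Delta> \<epsilon> \<G> (\<alpha> @ \<beta>) (perm_oplus ?k \<sigma> \<tau>) h =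
    convolution s \<Delta> (p_map s \<Delta> \<epsilon> \<G> \<alpha> \<sigma>) (p_map s \<Delta> \<epsilon> \<G> \<beta> \<tau>) h" .
qed

section \<open>Internal products and composition\<close>

definition matrix_product :: "nat \<Rightarrow> nat \<Rightarrow> (nat \<Rightarrow> nat) \<Rightarrow> nat list list \<Rightarrow> 'h list list \<Rightarrow> 'h" where
  "matrix_product k l \<rho> \<gamma> xss =
     prod_list (map (\<lambda>i. prod_list (map (\<lambda>j. hproj \<G> (\<gamma> ! i ! j) (xss ! j ! \<rho> i)) [0..<l])) [0..<k])"

text \<open>Counting from 0, entry (i, j) of \<gamma> has index l * i + j in
  \<open>concat \<gamma>\<close>. The arguments form l lists of length k, so part \<sigma>(i) of
  list \<tau>(j) has index k * \<tau>(j) + \<sigma>(i) in \<open>concat xss\<close>. The bracket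
  sends the former index to the latter.\<close>

lemma permuted_product_concat:
  assumes \<sigma>: "\<sigma> permutes {1..k}" and \<tau>: "\<tau> permutes {1..l}"
    and \<gamma>: "rectangular k l \<gamma>" and xss: "rectangular l k xss"
  shows "permuted_product (concat \<gamma>) (zero_based (perm_bracket k l \<tau> \<sigma>)) (concat xss) =
    matrix_product k l (zero_based \<sigma>) \<gamma> (map (\<lambda>j. xss ! zero_based \<tau> j) [0..<l])"
proof -
  let ?g = "\<lambda>n. hproj \<G> (concat \<gamma> ! n) (concat xss ! zero_based (perm_bracket k l \<tau> \<sigma>) n)"
  have "?g (l * i + j) = hproj \<G> (\<gamma> ! i ! j) (xss ! zero_based \<tau> j ! zero_based \<sigma> i)"
    if "i < k" "j < l" for i j
  proof -
    have "zero_based (perm_bracket k l \<tau> \<sigma>) (l * i + j) = k * zero_based \<tau> j + zero_based \<sigma> i"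
      using permutes_range[OF \<sigma>, of "Suc i"] that
      by (simp add: zero_based_def[of "perm_bracket k l \<tau> \<sigma>"] perm_bracket_block)
        (simp add: zero_based_def[of \<sigma>])
    moreover have "zero_based \<tau> j < l" "zero_based \<sigma> i < k"
      using permutes_in_image[OF zero_based_permutes[OF \<tau>], of j]
        permutes_in_image[OF zero_based_permutes[OF \<sigma>], of i] that by simp_all
    ultimately show ?thesis
      using that by (simp add: nth_concat_rectangular[OF \<gamma>] nth_concat_rectangular[OF xss])
  qed
  then have "map (\<lambda>i. prod_list (map (\<lambda>j. ?g (l * i + j)) [0..<l])) [0..<k] =
      map (\<lambda>i. prod_list (map (\<lambda>j. hproj \<G> (\<gamma> ! i ! j) (map (\<lambda>j. xss ! zero_based \<tau> j) [0..<l] ! j ! zero_based \<sigma> i)) [0..<l])) [0..<k]"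
    by (intro map_cong arg_cong[of _ _ prod_list]) auto
  then show ?thesis
    unfolding permuted_product_def matrix_product_def length_concat_rectangular[OF \<gamma>] prod_list_blocks
    by (simp only:)
qed

text \<open>With the identity in place of \<tau>, \<open>permuted_product_concat\<close> presents
  the matrix product as a permuted product of the concatenated rows, whose multilinearity passes to
  the rows.\<close>

lemma multilinear_rows_matrix_product:
  assumes \<sigma>: "\<sigma> permutes {1..k}" and \<gamma>: "rectangular k l \<gamma>"
  shows "multilinear_rows k l (matrix_product k l (zero_based \<sigma>) \<gamma>)"
proof (rule multilinear_rows_cong)
  let ?p = "perm_bracket k l id \<sigma>"
  have id: "id permutes {1..l}" by (rule permutes_id)
  have len: "length (concat \<gamma>) = l * k"
    by (simp add: length_concat_rectangular[OF \<gamma>])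
  have "zero_based ?p permutes {..<length (concat \<gamma>)}"
    using zero_based_permutes[OF perm_bracket_permutes[OF \<sigma> id]] by (simp only: length_concat_rectangular[OF \<gamma>])
  then have "multilinear (l * k) (permuted_product (concat \<gamma>) (zero_based ?p))"
    using multilinear_permuted_product len by metis
  then show "multilinear_rows k l (\<lambda>xss. permuted_product (concat \<gamma>) (zero_based ?p) (concat xss))"
    by (rule multilinear_rows_concat)
  fix xss :: "'h list list"
  assume xss: "rectangular l k xss"
  then have "map (\<lambda>j. xss ! zero_based id j) [0..<l] = xss"
    by (intro nth_equalityI) (auto simp: zero_based_def rectangular_def)
  then show "matrix_product k l (zero_based \<sigma>) \<gamma> xss = permuted_product (concat \<gamma>) (zero_based ?p) (concat xss)"
    using permuted_product_concat[OF \<sigma> id \<gamma> xss] by simp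
qed

lemma p_map_comp:
  assumes \<sigma>: "\<sigma> permutes {1..length \<alpha>}" and \<tau>: "\<tau> permutes {1..length \<beta>}"
  shows "p_map s \<Delta> \<epsilon> \<G> \<alpha> \<sigma> (p_map s \<Delta> \<epsilon> \<G> \<beta> \<tau> h) =
    (\<Sum>\<gamma>\<in>matrices \<alpha> \<beta>. p_map s \<Delta> \<epsilon> \<G> (concat \<gamma>) (perm_bracket (length \<alpha>) (length \<beta>) \<tau> \<sigma>) h)"
proof -
  define k l where "k = length \<alpha>" and "l = length \<beta>"
  define \<rho> \<pi> where "\<rho> = zero_based \<sigma>" and "\<pi> = zero_based \<tau>"
  note \<sigma>' = \<sigma>[folded k_def] and \<tau>' = \<tau>[folded l_def]
  have \<rho>: "\<rho> permutes {..<k}" and \<pi>: "\<pi> permutes {..<l}"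
    using zero_based_permutes[OF \<sigma>'] zero_based_permutes[OF \<tau>'] by (simp_all add: \<rho>_def \<pi>_def)
  have \<rho>_less: "\<rho> i < k" "inv \<rho> i < k" "inv \<rho> (\<rho> i) = i" if "i < k" for i
    using permutes_in_image[OF \<rho>, of i] permutes_in_image[OF permutes_inv[OF \<rho>], of i] that
    by (simp_all add: permutes_inverses[OF \<rho>])
  define P where "P = permuted_product \<alpha> \<rho>"
  have P: "multilinear k P"
    unfolding P_def k_def by (rule multilinear_permuted_product) (use \<rho> in \<open>simp add: k_def\<close>)
  \<comment> \<open>Only the row sums are imposed here. They come from splitting the projections to
    \<alpha>; the column sums will come from the projections to \<beta>.\<close>
  define rows where "rows = {\<gamma>. length \<gamma> = k \<and> (\<forall>i<k. \<gamma> ! i \<in> weak_compositions l (\<alpha> ! i))}"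
  have rect: "rectangular k l \<gamma>" if "\<gamma> \<in> rows" for \<gamma>
    using that by (auto simp: rows_def rectangular_def weak_compositions_def in_set_conv_nth)
  have "finite rows"
  proof (rule finite_subset)
    show "rows \<subseteq> {\<gamma>. set \<gamma> \<subseteq> (\<Union>i<k. weak_compositions l (\<alpha> ! i)) \<and> length \<gamma> = k}"
      by (fastforce simp: rows_def in_set_conv_nth)
  qed (intro finite_lists_length_eq finite_UN_I finite_lessThan finite_weak_compositions)
  \<comment> \<open>Row \<open>j\<close> of \<open>transposed \<gamma>\<close> lists the degrees of the factors of \<open>matrix_product\<close> taken from the
    \<open>j\<close>-th argument, in the order of their positions in that argument.\<close>
  define transposed where "transposed = (\<lambda>\<gamma> :: nat list list. map (\<lambda>j. map (\<lambda>r. \<gamma> ! inv \<rho> r ! j) [0..<k]) [0..<l])"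
  have expand: "P (column_products k xss) = (\<Sum>\<gamma>\<in>rows. matrix_product k l \<rho> \<gamma> xss)"
    if xss: "rectangular l k xss" for xss
  proof -
    let ?w = "\<lambda>i. map (\<lambda>xs. xs ! \<rho> i) xss"
    have w: "length (?w i) = l" for i
      using xss by (simp add: rectangular_def)
    have "P (column_products k xss) = prod_list (map (\<lambda>i. hproj \<G> (\<alpha> ! i) (prod_list (?w i))) [0..<k])"
      unfolding P_def permuted_product_def k_def[symmetric] using xss \<rho>_less(1)
      by (intro map_cong arg_cong[of _ _ prod_list]) (auto simp: nth_column_products rectangular_def)
    also have "\<dots> = prod_list (map (\<lambda>i. \<Sum>ns\<in>weak_compositions l (\<alpha> ! i). prod_list (map2 (hproj \<G>) ns (?w i))) [0..<k])"
      by (simp only: hproj_prod_list w)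
    also have "\<dots> = (\<Sum>\<gamma>\<in>rows. prod_list (map (\<lambda>i. prod_list (map2 (hproj \<G>) (\<gamma> ! i) (?w i))) [0..<k]))"
      unfolding rows_def by (rule prod_list_sum_distrib[OF finite_weak_compositions])
    also have "\<dots> = (\<Sum>\<gamma>\<in>rows. matrix_product k l \<rho> \<gamma> xss)"
    proof (rule sum.cong[OF refl])
      fix \<gamma> assume "\<gamma> \<in> rows"
      then have "map2 (hproj \<G>) (\<gamma> ! i) (?w i) = map (\<lambda>j. hproj \<G> (\<gamma> ! i ! j) (xss ! j ! \<rho> i)) [0..<l]" if "i < k" for i
        using that w[of i] by (intro nth_equalityI) (auto simp: rows_def weak_compositions_def)
      then show "prod_list (map (\<lambda>i. prod_list (map2 (hproj \<G>) (\<gamma> ! i) (?w i))) [0..<k]) = matrix_product k l \<rho> \<gamma> xss"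
        unfolding matrix_product_def by (intro map_cong arg_cong[of _ _ prod_list]) auto
    qed
    finally show ?thesis .
  qed
  have project: "sweedler_list k (map2 (hproj \<G>) \<beta> ys) (matrix_product k l \<rho> \<gamma>) =
      (if map sum_list (transposed \<gamma>) = \<beta> then sweedler_list k ys (matrix_product k l \<rho> \<gamma>) else 0)"
    if \<gamma>: "\<gamma> \<in> rows" and ys: "length ys = l" for \<gamma> ys
  proof (rule sweedler_list_hproj)
    show "multilinear_rows k (length ys) (matrix_product k l \<rho> \<gamma>)"
      unfolding ys \<rho>_def by (rule multilinear_rows_matrix_product[OF \<sigma>' rect[OF \<gamma>]])
    fix xss :: "'h list list"
    assume "rectangular (length ys) k xss"
    \<comment> \<open>Projecting the arguments to the degrees in \<open>transposed \<gamma>\<close>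
      has no effect, since \<open>matrix_product\<close> projects each factor to the very same
      degree.\<close>
    then have "map2 (map2 (hproj \<G>)) (transposed \<gamma>) xss ! j ! \<rho> i = hproj \<G> (\<gamma> ! i ! j) (xss ! j ! \<rho> i)"
      if "i < k" "j < l" for i j
      using that \<rho>_less ys by (simp add: transposed_def rectangular_def)
    then show "matrix_product k l \<rho> \<gamma> (map2 (map2 (hproj \<G>)) (transposed \<gamma>) xss) = matrix_product k l \<rho> \<gamma> xss"
      unfolding matrix_product_def by (intro map_cong arg_cong[of _ _ prod_list]) (auto simp: hproj_hproj)
  qed (auto simp: transposed_def ys l_def)
  have inner: "sweedler k (permuted_product \<beta> \<pi> ys) P =
      (\<Sum>\<gamma>\<in>{\<gamma> \<in> rows. map sum_list (transposed \<gamma>) = \<beta>}. sweedler_list k ys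
        (\<lambda>xss. permuted_product (concat \<gamma>) (zero_based (perm_bracket k l \<tau> \<sigma>)) (concat xss)))"
    if ys: "length ys = l" for ys
  proof -
    \<comment> \<open>Reordering the parts of h by \<pi> aligns them with \<beta>. Afterwards
      \<open>sweedler_list_permute\<close> passes the reordering on to the lists of their parts,
      where it supplies the \<tau> of the bracket.\<close>
    define ys' where "ys' = map (\<lambda>j. ys ! \<pi> j) [0..<l]"
    have ys': "length ys' = l" by (simp add: ys'_def)
    have "permuted_product \<beta> \<pi> ys = prod_list (map2 (hproj \<G>) \<beta> ys')"
      unfolding permuted_product_def ys'_def l_def
      by (intro arg_cong[of _ _ prod_list] nth_equalityI) auto
    then have "sweedler k (permuted_product \<beta> \<pi> ys) P =
        sweedler_list k (map2 (hproj \<G>) \<beta> ys') (\<lambda>xss. P (column_products k xss))"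
      by (simp add: sweedler_prod_list[OF P])
    also have "\<dots> = sweedler_list k (map2 (hproj \<G>) \<beta> ys') (\<lambda>xss. \<Sum>\<gamma>\<in>rows. matrix_product k l \<rho> \<gamma> xss)"
      by (rule sweedler_list_cong, rule expand) (simp add: ys' l_def)
    also have "\<dots> = (\<Sum>\<gamma>\<in>rows. if map sum_list (transposed \<gamma>) = \<beta> then sweedler_list k ys' (matrix_product k l \<rho> \<gamma>) else 0)"
      by (simp add: sweedler_list_sum project ys')
    also have "\<dots> = (\<Sum>\<gamma>\<in>{\<gamma> \<in> rows. map sum_list (transposed \<gamma>) = \<beta>}. sweedler_list k ys' (matrix_product k l \<rho> \<gamma>))"
      using \<open>finite rows\<close> by (rule sum.inter_filter[symmetric])
    also have "\<dots> = (\<Sum>\<gamma>\<in>{\<gamma> \<in> rows. map sum_list (transposed \<gamma>) = \<beta>}. sweedler_list k ys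
        (\<lambda>xss. permuted_product (concat \<gamma>) (zero_based (perm_bracket k l \<tau> \<sigma>)) (concat xss)))"
    proof (rule sum.cong[OF refl])
      fix \<gamma> assume "\<gamma> \<in> {\<gamma> \<in> rows. map sum_list (transposed \<gamma>) = \<beta>}"
      then have \<gamma>: "rectangular k l \<gamma>" using rect by simp
      show "sweedler_list k ys' (matrix_product k l \<rho> \<gamma>) = sweedler_list k ys
          (\<lambda>xss. permuted_product (concat \<gamma>) (zero_based (perm_bracket k l \<tau> \<sigma>)) (concat xss))"
        unfolding ys'_def sweedler_list_permute[OF \<pi> ys]
        by (rule sweedler_list_cong) (simp add: permuted_product_concat[OF \<sigma>' \<tau>' \<gamma>] ys \<rho>_def \<pi>_def)
    qed
    finally show ?thesis .
  qed
  have matrices: "matrices \<alpha> \<beta> = {\<gamma> \<in> rows. map sum_list (transposed \<gamma>) = \<beta>}"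
  proof -
    \<comment> \<open>Row j of \<open>transposed \<gamma>\<close> is column j of \<gamma> reordered
      by \<open>inv \<rho>\<close>, which leaves its sum unchanged.\<close>
    have col: "sum_list (map (\<lambda>r. \<gamma> ! inv \<rho> r ! j) [0..<k]) = (\<Sum>i<k. \<gamma> ! i ! j)" for \<gamma> :: "nat list list" and j
      using sum.permute[OF permutes_inv[OF \<rho>], of "\<lambda>i. \<gamma> ! i ! j"]
      by (simp add: interv_sum_list_conv_sum_set_nat atLeast0LessThan comp_def)
    have "map sum_list (transposed \<gamma>) = \<beta> \<longleftrightarrow> (\<forall>j<l. (\<Sum>i<k. \<gamma> ! i ! j) = \<beta> ! j)" for \<gamma>
    proof -
      have "map sum_list (transposed \<gamma>) = map (\<lambda>j. \<Sum>i<k. \<gamma> ! i ! j) [0..<l]"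
        unfolding transposed_def map_map comp_def col ..
      then show ?thesis
        by (simp only: list_eq_iff_nth_eq) (simp add: l_def)
    qed
    then show ?thesis
      by (auto simp: matrices_def rows_def weak_compositions_def sum_list_sum_nth atLeast0LessThan k_def l_def)
  qed
  have outer: "sweedler l h (\<lambda>ys. sweedler_list k ys
        (\<lambda>xss. permuted_product (concat \<gamma>) (zero_based (perm_bracket k l \<tau> \<sigma>)) (concat xss))) =
      p_map s \<Delta> \<epsilon> \<G> (concat \<gamma>) (perm_bracket k l \<tau> \<sigma>) h" if "\<gamma> \<in> rows" for \<gamma>
  proof -
    have len: "length (concat \<gamma>) = k * l"
      by (rule length_concat_rectangular[OF rect[OF that]])
    have perm: "perm_bracket k l \<tau> \<sigma> permutes {1..length (concat \<gamma>)}"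
      unfolding len by (rule perm_bracket_permutes[OF \<sigma>' \<tau>'])
    have "multilinear (l * k) (permuted_product (concat \<gamma>) (zero_based (perm_bracket k l \<tau> \<sigma>)))"
      using multilinear_permuted_product[OF zero_based_permutes[OF perm]] by (simp only: len mult.commute)
    from sweedler_concat[OF this, of h] show ?thesis
      unfolding p_map_sweedler[OF perm] len by (simp only: mult.commute)
  qed
  have "p_map s \<Delta> \<epsilon> \<G> \<alpha> \<sigma> (p_map s \<Delta> \<epsilon> \<G> \<beta> \<tau> h) = sweedler k (sweedler l h (permuted_product \<beta> \<pi>)) P"
    unfolding p_map_sweedler[OF \<sigma>] p_map_sweedler[OF \<tau>] by (simp only: k_def l_def \<rho>_def \<pi>_def P_def)
  also have "\<dots> = sweedler l h (\<lambda>ys. sweedler k (permuted_product \<beta> \<pi> ys) P)"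
    by (rule linear_map_apply_sweedler[OF linear_map_sweedler[OF P]])
  also have "\<dots> = sweedler l h (\<lambda>ys. \<Sum>\<gamma>\<in>matrices \<alpha> \<beta>. sweedler_list k ys
      (\<lambda>xss. permuted_product (concat \<gamma>) (zero_based (perm_bracket k l \<tau> \<sigma>)) (concat xss)))"
    unfolding matrices by (rule sweedler_cong[OF inner])
  also have "\<dots> = (\<Sum>\<gamma>\<in>matrices \<alpha> \<beta>. sweedler l h (\<lambda>ys. sweedler_list k ys
      (\<lambda>xss. permuted_product (concat \<gamma>) (zero_based (perm_bracket k l \<tau> \<sigma>)) (concat xss))))"
    by (rule sweedler_sum)
  also have "\<dots> = (\<Sum>\<gamma>\<in>matrices \<alpha> \<beta>. p_map s \<Delta> \<epsilon> \<G> (concat \<gamma>) (perm_bracket k l \<tau> \<sigma>) h)"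
    by (rule sum.cong[OF refl], rule outer) (simp add: matrices)
  finally show ?thesis by (simp only: k_def l_def)
qed

section \<open>Invariance under reduction\<close>

lemma prod_list_hproj_zero:
  "prod_list (map (\<lambda>i. hproj \<G> (\<alpha> ! i) (x i)) is) =
    s (prod_list (map (\<lambda>i. \<epsilon> (x i)) (filter (\<lambda>i. \<alpha> ! i = 0) is)))
      (prod_list (map (\<lambda>i. hproj \<G> (\<alpha> ! i) (x i)) (filter (\<lambda>i. \<alpha> ! i \<noteq> 0) is)))"
  by (induction "is")
    (simp_all add: scale_one hproj_0 scale_mult_left scale_mult_right scale_scale mult.commute)

text \<open>Slot i reads position \<open>\<rho> i\<close> of the comultiplication. The slots with
  zero degree contract their positions, so only the set \<open>S\<close> of the remaining ones
  survives, and a position m in \<open>S\<close> is renumbered to the number of elements of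
  \<open>S\<close> below m. Standardizing the surviving values of \<sigma> produces the same
  numbers, so \<tau> reads the same factors.\<close>

lemma p_map_red:
  assumes "weak_mopiscotion \<alpha> \<sigma>" "Rep_mopiscotion (red \<alpha> \<sigma>) = (\<beta>, \<tau>)"
  shows "p_map s \<Delta> \<epsilon> \<G> \<beta> \<tau> = p_map s \<Delta> \<epsilon> \<G> \<alpha> \<sigma>"
proof
  fix h
  define k where "k = length \<alpha>"
  have \<sigma>: "\<sigma> permutes {1..k}" using assms(1) by (simp add: weak_mopiscotion_def k_def)
  define \<rho> where "\<rho> = zero_based \<sigma>"
  have \<rho>: "\<rho> permutes {..<k}" unfolding \<rho>_def by (rule zero_based_permutes[OF \<sigma>])
  have \<rho>_eq: "\<rho> i = \<rho> j \<longleftrightarrow> i = j" for i j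
    using inj_eq[OF permutes_inj[OF \<rho>]] .
  have \<sigma>_Suc: "\<sigma> (Suc i) = Suc (\<rho> i)" if "i < k" for i
    using permutes_range[OF \<sigma>, of "Suc i"] that by (simp add: \<rho>_def zero_based_def)
  define js where "js = filter (\<lambda>i. \<alpha> ! i \<noteq> 0) [0..<k]"
  define w where "w = map (\<lambda>i. \<sigma> (Suc i)) js"
  have js: "distinct js" "set js = {i. i < k \<and> \<alpha> ! i \<noteq> 0}" by (auto simp: js_def)
  have w: "distinct w" "length w = length js"
    using js(1) inj_eq[OF permutes_inj[OF \<sigma>]] by (auto simp: w_def distinct_map inj_on_def)
  have "[1..<k + 1] = map Suc [0..<k]"
    by (simp add: map_Suc_upt del: upt_Suc)
  then have filter_eq: "filter (\<lambda>i. \<alpha> ! (i - 1) \<noteq> 0) [1..<k + 1] = map Suc js"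
    by (simp add: js_def filter_map comp_def del: upt_Suc)
  have "red \<alpha> \<sigma> = Abs_mopiscotion (map ((!) \<alpha>) js, standardization w)"
    unfolding red_def k_def[symmetric] filter_eq Let_def by (simp add: w_def comp_def)
  moreover have "(map ((!) \<alpha>) js, standardization w) \<in> {(\<alpha>, \<sigma>). weak_mopiscotion \<alpha> \<sigma> \<and> 0 \<notin> set \<alpha>}"
  proof -
    have "standardization w permutes {1..length js}"
      using standardization_distinct(1)[OF w(1)] unfolding w(2) .
    moreover have "0 \<notin> set (map ((!) \<alpha>) js)" by (simp add: js(2) image_iff)
    ultimately show ?thesis by (simp add: weak_mopiscotion_def)
  qed
  ultimately have \<beta>: "\<beta> = map ((!) \<alpha>) js" and \<tau>: "\<tau> = standardization w"
    using assms(2) by (simp_all add: Abs_mopiscotion_inverse)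
  have \<tau>_perm: "\<tau> permutes {1..length \<beta>}"
    using standardization_distinct(1)[OF w(1)] w(2) by (simp add: \<beta> \<tau>)
  define S where "S = \<rho> ` set js"
  have S_less: "S \<subseteq> {..<k}"
    using image_mono[of "set js" "{..<k}" \<rho>] js(2) by (auto simp: S_def permutes_image[OF \<rho>])
  have card_S: "card S = length js"
    using card_image[OF permutes_inj_on[OF \<rho>]] distinct_card[OF js(1)] by (simp add: S_def)
  have js_less: "js ! a < k" if "a < length js" for a
    using nth_mem[OF that] js(2) by simp
  have rank: "zero_based \<tau> a = card {m \<in> S. m < \<rho> (js ! a)}" if a: "a < length js" for a
  proof -
    let ?J = "{c. c < length js \<and> \<rho> (js ! c) < \<rho> (js ! a)}"
    \<comment> \<open>Ranks in the standardization start at 1 because an entry counts itself,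
      whereas \<open>?J\<close> holds the strictly smaller entries. This accounts for the extra
      element \<open>a\<close>, whose contribution \<open>zero_based\<close> removes again.\<close>
    have "{c \<in> {1..length w}. w ! (c - 1) \<le> w ! a} = Suc ` insert a ?J"
    proof (intro equalityI subsetI)
      fix c assume c: "c \<in> {c \<in> {1..length w}. w ! (c - 1) \<le> w ! a}"
      then obtain d where d: "c = Suc d" "d < length js" using w(2) by (cases c) auto
      then have "\<rho> (js ! d) \<le> \<rho> (js ! a)"
        using c a by (simp add: w_def \<sigma>_Suc js_less)
      then have "d \<in> insert a ?J"
        using d a nth_eq_iff_index_eq[OF js(1) d(2) a] by (auto simp: order_le_less \<rho>_eq)
      then show "c \<in> Suc ` insert a ?J"
        using d(1) by blast
    qed (use a w(2) in \<open>auto simp: w_def \<sigma>_Suc js_less\<close>)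
    then have "card {c \<in> {1..length w}. w ! (c - 1) \<le> w ! a} = card (insert a ?J)"
      by (simp only: card_image[OF inj_on_subset[OF inj_Suc subset_UNIV]])
    also have "\<dots> = Suc (card ?J)"
      by (rule card_insert_disjoint) auto
    finally have "card {c \<in> {1..length w}. w ! (c - 1) \<le> w ! a} = Suc (card ?J)" .
    then have "zero_based \<tau> a = card ?J"
      using standardization_distinct(2)[OF w(1), of "Suc a"] a w(2) by (simp add: zero_based_def \<tau>)
    also have "\<dots> = card ((\<lambda>c. \<rho> (js ! c)) ` ?J)"
      by (rule card_image[symmetric]) (auto simp: inj_on_def \<rho>_eq nth_eq_iff_index_eq[OF js(1)])
    also have "(\<lambda>c. \<rho> (js ! c)) ` ?J = {m \<in> S. m < \<rho> (js ! a)}"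
      by (auto simp: S_def set_conv_nth)
    finally show ?thesis .
  qed
  have split: "permuted_product \<alpha> \<rho> xs =
      s (\<Prod>m\<in>{..<length xs} - S. \<epsilon> (xs ! m)) (permuted_product \<beta> (zero_based \<tau>) (nths xs S))"
    if xs: "length xs = k" for xs
  proof -
    let ?Z = "{i. i < k \<and> \<alpha> ! i = 0}"
    have "\<rho> ` ?Z = {..<k} - S"
    proof -
      have "?Z = {..<k} - set js" unfolding js(2) by auto
      then show ?thesis
        by (simp only: image_set_diff[OF permutes_inj[OF \<rho>]] permutes_image[OF \<rho>] S_def)
    qed
    then have "(\<Prod>m\<in>{..<length xs} - S. \<epsilon> (xs ! m)) = (\<Prod>i\<in>?Z. \<epsilon> (xs ! \<rho> i))"
      using prod.reindex[of \<rho> ?Z "\<lambda>m. \<epsilon> (xs ! m)"] xs by (simp add: inj_on_def \<rho>_eq comp_def)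
    also have "\<dots> = prod_list (map (\<lambda>i. \<epsilon> (xs ! \<rho> i)) (filter (\<lambda>i. \<alpha> ! i = 0) [0..<k]))"
      by (subst prod.distinct_set_conv_list[symmetric]) (auto intro!: prod.cong)
    finally have 1: "(\<Prod>m\<in>{..<length xs} - S. \<epsilon> (xs ! m)) =
      prod_list (map (\<lambda>i. \<epsilon> (xs ! \<rho> i)) (filter (\<lambda>i. \<alpha> ! i = 0) [0..<k]))" .
    have "nths xs S ! zero_based \<tau> a = xs ! \<rho> (js ! a)" if a: "a < length js" for a
    proof -
      have "\<rho> (js ! a) \<in> S" using a by (simp add: S_def)
      then show ?thesis
        unfolding rank[OF a] using S_less xs by (intro nth_nths) auto
    qed
    then have "map (\<lambda>a. hproj \<G> (\<beta> ! a) (nths xs S ! zero_based \<tau> a)) [0..<length \<beta>] =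
        map (\<lambda>i. hproj \<G> (\<alpha> ! i) (xs ! \<rho> i)) js"
      by (intro nth_equalityI) (auto simp: \<beta>)
    then have 2: "permuted_product \<beta> (zero_based \<tau>) (nths xs S) =
        prod_list (map (\<lambda>i. hproj \<G> (\<alpha> ! i) (xs ! \<rho> i)) js)"
      by (simp only: permuted_product_def)
    show ?thesis
      unfolding 1 2 js_def unfolding permuted_product_def k_def[symmetric] by (rule prod_list_hproj_zero)
  qed
  have card: "card (S \<inter> {..<k}) = length \<beta>"
    using S_less card_S by (simp add: Int_absorb2 \<beta>)
  have "p_map s \<Delta> \<epsilon> \<G> \<alpha> \<sigma> h = sweedler k h
      (\<lambda>xs. s (\<Prod>m\<in>{..<length xs} - S. \<epsilon> (xs ! m)) (permuted_product \<beta> (zero_based \<tau>) (nths xs S)))"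
    using p_map_sweedler[OF \<sigma>[unfolded k_def], of h] sweedler_cong[OF split]
    by (simp add: \<rho>_def k_def)
  also have "\<dots> = sweedler (length \<beta>) h (permuted_product \<beta> (zero_based \<tau>))"
    using sweedler_counit[of S k, unfolded card, OF multilinear_permuted_product[OF zero_based_permutes[OF \<tau>_perm]]] .
  also have "\<dots> = p_map s \<Delta> \<epsilon> \<G> \<beta> \<tau> h"
    by (rule p_map_sweedler[OF \<tau>_perm, symmetric])
  finally show "p_map s \<Delta> \<epsilon> \<G> \<beta> \<tau> h = p_map s \<Delta> \<epsilon> \<G> \<alpha> \<sigma> h" ..
qed

section \<open>The action of PNSym\<close>

definition basis_act :: "mopiscotion \<Rightarrow> 'h \<Rightarrow> 'h" where
  "basis_act a = (case Rep_mopiscotion a of (\<alpha>, \<sigma>) \<Rightarrow> p_map s \<Delta> \<epsilon> \<G> \<alpha> \<sigma>)"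

definition pnsym_act :: "'k pnsym \<Rightarrow> 'h \<Rightarrow> 'h" where
  "pnsym_act u h = lin_ext s (\<lambda>a. basis_act a h) u"

lemma Rep_mopiscotion_permutes:
  "Rep_mopiscotion a = (\<alpha>, \<sigma>) \<Longrightarrow> \<sigma> permutes {1..length \<alpha>}"
  using Rep_mopiscotion[of a] by (simp add: weak_mopiscotion_def)

lemma linear_map_basis_act: "linear_map s s (basis_act a)"
  using Rep_mopiscotion_permutes[of a] linear_map_p_map
  by (cases "Rep_mopiscotion a") (simp add: basis_act_def)

lemma linear_map_pnsym_act: "linear_map s s (pnsym_act u)"
  unfolding pnsym_act_def[abs_def] by (rule linear_map_lin_ext_fun) (rule linear_map_basis_act)

lemma linear_map_pnsym_act_left: "linear_map fscale s (\<lambda>u. pnsym_act u h)"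
  unfolding pnsym_act_def by (rule linear_map_lin_ext_arg)

text \<open>\<open>F\<close> reduces its index before forming the basis element, so for weak
  mopiscotions this is the invariance of \<open>p_map\<close> under reduction.\<close>

lemma pnsym_act_F: "weak_mopiscotion \<alpha> \<sigma> \<Longrightarrow> pnsym_act (F \<alpha> \<sigma>) = p_map s \<Delta> \<epsilon> \<G> \<alpha> \<sigma>"
  using p_map_red[of \<alpha> \<sigma>]
  by (cases "Rep_mopiscotion (red \<alpha> \<sigma>)")
    (auto simp: pnsym_act_def F_def lin_ext_single scale_one basis_act_def)

text \<open>For a fixed h the action is linear in the algebra element, so both multiplications need
  only be examined on pairs of basis elements.\<close>

lemma pnsym_act_bilin_ext:
  assumes "\<And>a b \<alpha> \<sigma> \<beta> \<tau>. Rep_mopiscotion a = (\<alpha>, \<sigma>) \<Longrightarrow> Rep_mopiscotion b = (\<beta>, \<tau>) \<Longrightarrow>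
    pnsym_act (f \<alpha> \<sigma> \<beta> \<tau>) h = g a b"
  shows "pnsym_act (bilin_ext f u v) h = lin_ext s (\<lambda>a. lin_ext s (\<lambda>b. g a b) v) u"
proof -
  have "pnsym_act (case (Rep_mopiscotion a, Rep_mopiscotion b) of ((\<alpha>, \<sigma>), (\<beta>, \<tau>)) \<Rightarrow> f \<alpha> \<sigma> \<beta> \<tau>) h = g a b" for a b
    using assms[of a _ _ b] by (simp split: prod.split)
  then show ?thesis
    unfolding bilin_ext_def
    by (simp only: linear_map_lin_ext[OF linear_map_pnsym_act_left])
qed

lemma pnsym_act_int_mult: "pnsym_act (int_mult u v) h = pnsym_act u (pnsym_act v h)"
proof -
  have "pnsym_act (int_mult u v) h = lin_ext s (\<lambda>a. lin_ext s (\<lambda>b. basis_act a (basis_act b h)) v) u"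
    unfolding int_mult_def
  proof (rule pnsym_act_bilin_ext)
    fix a b \<alpha> \<sigma> \<beta> \<tau>
    assume ab: "Rep_mopiscotion a = (\<alpha>, \<sigma>)" "Rep_mopiscotion b = (\<beta>, \<tau>)"
    let ?p = "perm_bracket (length \<alpha>) (length \<beta>) \<tau> \<sigma>"
    have perm: "\<sigma> permutes {1..length \<alpha>}" "\<tau> permutes {1..length \<beta>}"
      using ab Rep_mopiscotion_permutes by blast+
    have "weak_mopiscotion (concat \<gamma>) ?p" if "\<gamma> \<in> matrices \<alpha> \<beta>" for \<gamma>
    proof -
      have "rectangular (length \<alpha>) (length \<beta>) \<gamma>"
        using that by (auto simp: matrices_def rectangular_def in_set_conv_nth)
      then show ?thesis
        using perm_bracket_permutes[OF perm] by (simp only: weak_mopiscotion_def length_concat_rectangular)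
    qed
    then show "pnsym_act (\<Sum>\<gamma>\<in>matrices \<alpha> \<beta>. F (concat \<gamma>) ?p) h = basis_act a (basis_act b h)"
      by (simp add: linear_map_sum[OF linear_map_pnsym_act_left] pnsym_act_F basis_act_def ab p_map_comp[OF perm])
  qed
  also have "\<dots> = pnsym_act u (pnsym_act v h)"
    unfolding pnsym_act_def by (simp only: linear_map_lin_ext[OF linear_map_basis_act])
  finally show ?thesis .
qed

lemma pnsym_act_ext_mult: "pnsym_act (ext_mult u v) = convolution s \<Delta> (pnsym_act u) (pnsym_act v)"
proof
  fix h
  have "pnsym_act (ext_mult u v) h =
      lin_ext s (\<lambda>a. lin_ext s (\<lambda>b. sweedler2 h (\<lambda>x y. basis_act a x * basis_act b y)) v) u"
    unfolding ext_mult_def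
  proof (rule pnsym_act_bilin_ext)
    fix a b \<alpha> \<sigma> \<beta> \<tau>
    assume ab: "Rep_mopiscotion a = (\<alpha>, \<sigma>)" "Rep_mopiscotion b = (\<beta>, \<tau>)"
    have perm: "\<sigma> permutes {1..length \<alpha>}" "\<tau> permutes {1..length \<beta>}"
      using ab Rep_mopiscotion_permutes by blast+
    have "weak_mopiscotion (\<alpha> @ \<beta>) (perm_oplus (length \<alpha>) \<sigma> \<tau>)"
      using perm_oplus_permutes[OF perm] by (simp add: weak_mopiscotion_def)
    then show "pnsym_act (F (\<alpha> @ \<beta>) (perm_oplus (length \<alpha>) \<sigma> \<tau>)) h =
        sweedler2 h (\<lambda>x y. basis_act a x * basis_act b y)"
      by (simp add: pnsym_act_F p_map_append[OF perm] basis_act_def ab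
        convolution_sweedler2[OF linear_map_p_map[OF perm(1)] linear_map_p_map[OF perm(2)]])
  qed
  \<comment> \<open>The sums over the supports of \<open>u\<close> and \<open>v\<close> are pulled
    inside the sum over the terms of \<open>\<Delta> h\<close>, where they act on the two factors
    separately.\<close>
  also have "\<dots> = sweedler2 h (\<lambda>x y. pnsym_act u x * pnsym_act v y)"
    unfolding pnsym_act_def sweedler2_def tlift_def
    by (simp only: linear_map_lin_ext[OF linear_map_mult_left[OF linear_map_id]],
        simp only: linear_map_lin_ext[OF linear_map_mult_right[OF linear_map_id]] lin_ext_swap[where y = "trep (\<Delta> h)"])
  also have "\<dots> = convolution s \<Delta> (pnsym_act u) (pnsym_act v) h"
    by (rule convolution_sweedler2[symmetric]) (rule linear_map_pnsym_act)+
  finally show "pnsym_act (ext_mult u v) h = convolution s \<Delta> (pnsym_act u) (pnsym_act v) h" .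
qed

end

theorem theorem2p9:
  fixes s :: "'k::{comm_ring, comm_monoid_mult} \<Rightarrow> 'h::{ring, monoid_mult} \<Rightarrow> 'h"
    and \<Delta> :: "'h \<Rightarrow> ('h, 'k) tensor"
    and \<epsilon> :: "'h \<Rightarrow> 'k"
    and \<G> :: "nat \<Rightarrow> 'h set"
  assumes "connected_graded_bialgebra s \<Delta> \<epsilon> \<G>"
  shows "\<exists>act :: 'k pnsym \<Rightarrow> 'h \<Rightarrow> 'h.
    nonunital_module fscale int_mult s act
    \<and> (\<forall>\<alpha> \<sigma>. weak_mopiscotion \<alpha> \<sigma> \<longrightarrow> act (F \<alpha> \<sigma>) = p_map s \<Delta> \<epsilon> \<G> \<alpha> \<sigma>)
    \<and> (\<forall>u v. act (ext_mult u v) = convolution s \<Delta> (act u) (act v))"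
proof -
  interpret connected_graded_bialgebra s \<Delta> \<epsilon> \<G> by (rule assms)
  have "nonunital_module fscale int_mult s pnsym_act"
    by (simp add: nonunital_module_def unital_module_axioms linear_map_pnsym_act
      linear_map_pnsym_act_left pnsym_act_int_mult)
  then show ?thesis
    using pnsym_act_F pnsym_act_ext_mult by blast
qed

end
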